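(* Let $\zeta_{i,j}=U(\kappa^i\xi^j)$ for $i,j\ge0$. Then for any $i\ge 2$ and $j\ge 0$, $$\zeta_{i,j}=(10\xi^3-40\xi^4+32\xi^5)\,\zeta_{i-1,j}-\xi^5\,\zeta_{i-2,j},$$ and for any $i\ge 0$ and $j\ge 2$, $$\zeta_{i,j}=(10\xi-8\xi^2)\,\zeta_{i,j-1}-(9\xi-8\xi^2)\,\zeta_{i,j-2}.$$
   Context: Let $E(q)=\prod_{m\ge1}(1-q^m)$. Define $$\gamma(q)=\frac{E(q)^5E(q^2)^5E(q^6)^5}{E(q^3)^{15}},\qquad \xi=\xi(q)=\frac{E(q^2)^5E(q^6)}{E(q)E(q^3)^5},\qquad \kappa=\kappa(q)=\frac{\gamma(q^2)^2}{\gamma(q)}.$$ $U$ is the operator on power series given by $U\left(\sum_n a_nq^n\right)=\sum_n a_{2n}q^n$. All identities are identities of formal power series in $q$. *)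

theory Defs
  imports "HOL-Computational_Algebra.Formal_Power_Series"
begin

text \<open>Euler's product E(q) = prod_{m>=1} (1 - q^m) as a formal power series over the rationals.
  The coefficient of q^n only depends on the factors with m <= n, so the infinite product is
  given coefficientwise by the finite truncations.\<close>
definition E :: "rat fps" where
  "E = Abs_fps (\<lambda>n. fps_nth (\<Prod>m\<in>{1..n}. (1 - fps_X ^ m :: rat fps)) n)"

definition dil :: "nat \<Rightarrow> rat fps \<Rightarrow> rat fps" where
  "dil k f = fps_compose f (fps_X ^ k)"

definition gam :: "rat fps" where
  "gam = E ^ 5 * dil 2 E ^ 5 * dil 6 E ^ 5 * inverse (dil 3 E ^ 15)"

definition xi :: "rat fps" where
  "xi = dil 2 E ^ 5 * dil 6 E * inverse (E * dil 3 E ^ 5)"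

definition kappa :: "rat fps" where
  "kappa = dil 2 gam ^ 2 * inverse gam"

definition U :: "rat fps \<Rightarrow> rat fps" where
  "U f = Abs_fps (\<lambda>n. fps_nth f (2 * n))"

definition zeta :: "nat \<Rightarrow> nat \<Rightarrow> rat fps" where
  "zeta i j = U (kappa ^ i * xi ^ j)"

end

theory Submission
  imports
    Defs
    "HOL-Computational_Algebra.Polynomial"
    "HOL-Computational_Algebra.Formal_Laurent_Series"
begin

text \<open>
  Everything is governed by one odd series \<open>u = q E(q^2)^2 E(q^12)^4 / (E(q^4)^4 E(q^6)^2)\<close>. The
  eta quotients \<open>h\<close> and \<open>g\<close> defined below turn out to be \<open>1 + u\<close> and \<open>1 - 3u\<close>, and then
  \<open>\<xi>(q^2) = 1 / (1 - u^2)\<close>, \<open>\<xi>(q) = (1 + 3u) / (1 + u)^2\<close> and \<open>\<kappa> = (1 - u)^(-5)\<close>. As \<open>q \<mapsto> -q\<close> maps \<open>u\<close> to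
  \<open>-u\<close>, both \<open>\<xi>\<close> and \<open>\<kappa>\<close> are roots of quadratic polynomials whose coefficients are polynomials in
  \<open>\<xi>(q^2)\<close>, and \<open>U\<close> turns these quadratic equations into the recurrences.

  To find \<open>h\<close> and \<open>g\<close>, write \<open>h', g'\<close> for their images under \<open>q \<mapsto> -q\<close>. The classical identities
  \<open>\<phi>(q)^4 - \<phi>(-q)^4 = 16 q \<psi>(q^2)^4\<close> (for \<open>q\<close> and for \<open>q^3\<close>) and
  \<open>\<phi>(q) \<phi>(q^3) - \<phi>(-q) \<phi>(-q^3) = 4 q \<psi>(q^2) \<psi>(q^6)\<close> become three polynomial relations between
  \<open>h, h', g, g', u\<close>, which force \<open>h = s + u\<close> and \<open>g s = s - 3u\<close> for some even series \<open>s\<close>. Multiplicative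
  relations among eta quotients show that \<open>s^2\<close> is invariant under \<open>q \<mapsto> q^2\<close>, so \<open>s = 1\<close>.
\<close>

unbundle fps_syntax

section \<open>Coefficientwise limits\<close>

text \<open>Convergence means that each coefficient is eventually constant, and coefficient
  \<open>n\<close> of a product involves only coefficients up to \<open>n\<close> of the
  factors.\<close>

lemma tendsto_fps_mult:
  fixes f g :: "'b \<Rightarrow> 'a::ring_1 fps"
  assumes "(f \<longlongrightarrow> a) F" "(g \<longlongrightarrow> b) F"
  shows "((\<lambda>x. f x * g x) \<longlongrightarrow> a * b) F"
proof (rule tendsto_fpsI)
  fix n
  have "eventually (\<lambda>x. \<forall>i\<in>{0..n}. f x $ i = a $ i) F" "eventually (\<lambda>x. \<forall>i\<in>{0..n}. g x $ i = b $ i) F"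
    using assms by (auto simp: tendsto_fps_iff intro!: eventually_ball_finite)
  then show "eventually (\<lambda>x. (f x * g x) $ n = (a * b) $ n) F"
    by eventually_elim (auto simp: fps_mult_nth intro!: sum.cong)
qed

lemma tendsto_fps_inverse:
  fixes f :: "'b \<Rightarrow> 'a::field fps"
  assumes "(f \<longlongrightarrow> a) F" "a $ 0 \<noteq> 0"
  shows "((\<lambda>x. inverse (f x)) \<longlongrightarrow> inverse a) F"
proof (rule tendsto_fpsI)
  fix n
  have "eventually (\<lambda>x. \<forall>i\<in>{0..n}. f x $ i = a $ i) F"
    using assms by (auto simp: tendsto_fps_iff intro!: eventually_ball_finite)
  then show "eventually (\<lambda>x. inverse (f x) $ n = inverse a $ n) F"
  proof eventually_elim
    case (elim x)
    then have "f x $ 0 \<noteq> 0" using assms(2) by auto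
    \<comment> \<open>The difference of the inverses is a multiple of \<open>a - f x\<close>, whose
      coefficients up to \<open>n\<close> vanish.\<close>
    then have "inverse (f x) - inverse a = inverse (f x) * inverse a * (a - f x)"
      using assms(2) inverse_mult_eq_1[of a] inverse_mult_eq_1[of "f x"]
      by (simp add: algebra_simps)
    moreover have "(inverse (f x) * inverse a * (a - f x)) $ n = 0"
      using elim by (subst fps_mult_nth) (auto intro!: sum.neutral)
    ultimately show ?case by (metis eq_iff_diff_eq_0 fps_sub_nth)
  qed
qed

lemma tendsto_dil:
  assumes "(f \<longlongrightarrow> a) F"
  shows "((\<lambda>x. dil k (f x)) \<longlongrightarrow> dil k a) F"
proof (rule tendsto_fpsI)
  fix n
  have "eventually (\<lambda>x. \<forall>i\<in>{0..n}. f x $ i = a $ i) F"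
    using assms by (auto simp: tendsto_fps_iff intro!: eventually_ball_finite)
  then show "eventually (\<lambda>x. dil k (f x) $ n = dil k a $ n) F"
    by eventually_elim (auto simp: dil_def fps_compose_nth intro!: sum.cong)
qed

section \<open>The substitutions \<open>q \<mapsto> q^k\<close> and \<open>q \<mapsto> -q\<close>\<close>

definition qneg :: "rat fps \<Rightarrow> rat fps" where
  "qneg f = fps_compose f (- fps_X)"

lemma qneg_nth: "qneg f $ n = (- 1) ^ n * f $ n"
proof -
  have "(- fps_X :: rat fps) = fps_const (- 1) * fps_X"
    by (metis fps_const_1_eq_1 fps_const_neg mult_minus1)
  then show ?thesis unfolding qneg_def by (simp only: fps_nth_compose_linear)
qed

lemma dil_nth:
  assumes "k \<ge> 1"
  shows "dil k f $ n = (if k dvd n then f $ (n div k) else 0)"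
proof -
  have *: "f $ i * (fps_X ^ k) ^ i $ n = (if n = k * i then f $ i else 0)" for i
    by (simp flip: power_mult)
  have "dil k f $ n = (\<Sum>i\<in>{0..n}. if n = k * i then f $ i else 0)"
    unfolding dil_def fps_compose_nth * ..
  also have "\<dots> = (if k dvd n then f $ (n div k) else 0)"
  proof (cases "k dvd n")
    case True
    have "(n = k * i) = (i = n div k)" for i using True assms by auto
    then show ?thesis using True by simp
  next
    case False
    then show ?thesis by (auto intro!: sum.neutral)
  qed
  finally show ?thesis .
qed

lemma qneg_mult: "qneg (f * g) = qneg f * qneg g"
  and qneg_add: "qneg (f + g) = qneg f + qneg g"
  and qneg_diff: "qneg (f - g) = qneg f - qneg g"
  and qneg_power: "qneg (f ^ n) = qneg f ^ n"
  by (simp_all add: qneg_def fps_compose_mult_distrib fps_compose_add_distrib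
      fps_compose_sub_distrib fps_compose_power)

lemma dil_mult: "k \<ge> 1 \<Longrightarrow> dil k (f * g) = dil k f * dil k g"
  and dil_add: "dil k (f + g) = dil k f + dil k g"
  and dil_diff: "dil k (f - g) = dil k f - dil k g"
  and dil_power: "k \<ge> 1 \<Longrightarrow> dil k (f ^ n) = dil k f ^ n"
  and dil_prod: "k \<ge> 1 \<Longrightarrow> dil k (prod h S) = (\<Prod>i\<in>S. dil k (h i))"
  by (simp_all add: dil_def fps_compose_mult_distrib fps_compose_add_distrib
      fps_compose_sub_distrib fps_compose_power fps_compose_prod_distrib)

lemma dil_of_one [simp]: "dil k 1 = 1"
  and dil_numeral [simp]: "dil k (numeral m) = numeral m"
  by (simp_all add: dil_def)

lemma qneg_1 [simp]: "qneg 1 = 1"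
  and qneg_numeral [simp]: "qneg (numeral m) = numeral m"
  by (simp_all add: qneg_def)

lemma dil_X: "k \<ge> 1 \<Longrightarrow> dil k fps_X = fps_X ^ k"
  by (simp add: dil_def)

lemma qneg_X: "qneg fps_X = - fps_X"
  by (simp add: qneg_def)

lemma dil_Suc_0 [simp]: "dil (Suc 0) f = f"
  by (simp add: dil_def)

lemma dil_dil: "j \<ge> 1 \<Longrightarrow> k \<ge> 1 \<Longrightarrow> dil j (dil k f) = dil (j * k) f"
  by (rule fps_ext) (auto simp: dil_nth div_mult2_eq elim!: dvdE)

lemma qneg_dil_even: "even k \<Longrightarrow> k \<ge> 1 \<Longrightarrow> qneg (dil k f) = dil k f"
  by (rule fps_ext) (auto simp: dil_nth qneg_nth)

lemma qneg_dil_odd: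
  assumes "odd k"
  shows "qneg (dil k f) = dil k (qneg f)"
proof -
  have "k \<ge> 1" using odd_pos[OF assms] by simp
  then show ?thesis
    using assms by (intro fps_ext) (auto simp: dil_nth qneg_nth minus_one_power_iff)
qed

lemma qneg_qneg [simp]: "qneg (qneg f) = f"
  by (rule fps_ext) (simp add: qneg_nth flip: mult.assoc power_add)

lemma dil_nth_0: "dil k f $ 0 = f $ 0"
  by (simp add: dil_def)

lemma dil_inverse:
  assumes "k \<ge> 1" "f $ 0 \<noteq> 0"
  shows "dil k (inverse f) = inverse (dil k f)"
proof -
  have "dil k (inverse f) * dil k f = 1"
    using assms by (simp flip: dil_mult add: inverse_mult_eq_1)
  then show ?thesis using assms(2)
    by (metis dil_nth_0 fps_inverse_unique mult.commute)
qed

lemma qneg_inverse: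
  assumes "f $ 0 \<noteq> 0"
  shows "qneg (inverse f) = inverse (qneg f)"
proof -
  have "qneg (inverse f) * qneg f = 1"
    using assms by (simp flip: qneg_mult add: inverse_mult_eq_1)
  then show ?thesis using assms
    by (metis fps_inverse_unique mult.commute)
qed

section \<open>Gaussian binomial coefficients\<close>

text \<open>The q-Pochhammer symbol (Q;Q)_n, over any commutative ring so that \<open>Q\<close> can
  be a power of X as well as -X.\<close>

definition qpoch :: "'a::comm_ring_1 \<Rightarrow> nat \<Rightarrow> 'a" where
  "qpoch Q n = (\<Prod>i\<in>{1..n}. 1 - Q ^ i)"

lemma qpoch_0 [simp]: "qpoch Q 0 = 1"
  and qpoch_Suc [simp]: "qpoch Q (Suc n) = qpoch Q n * (1 - Q ^ Suc n)"
  by (simp_all add: qpoch_def)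

text \<open>The Pascal rule avoids dividing by Pochhammer symbols; \<open>qbin_qpoch\<close>
  recovers the quotient form. Where \<open>n - k\<close> is truncated, the factor
  \<open>qbin Q n k\<close> is 0.\<close>

fun qbin :: "'a::comm_ring_1 \<Rightarrow> nat \<Rightarrow> nat \<Rightarrow> 'a" where
  "qbin Q n 0 = 1"
| "qbin Q 0 (Suc k) = 0"
| "qbin Q (Suc n) (Suc k) = qbin Q n (Suc k) + Q ^ (n - k) * qbin Q n k"

lemma qbin_eq_0: "k > n \<Longrightarrow> qbin Q n k = 0"
  by (induction Q n k rule: qbin.induct) auto

lemma qbin_qpoch: "k \<le> n \<Longrightarrow> qbin Q n k * qpoch Q k * qpoch Q (n - k) = qpoch Q n"
proof (induction Q n k rule: qbin.induct)
  case (3 Q n k)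
  show ?case
  proof (cases "k = n")
    case True
    then show ?thesis using 3 by (simp add: qbin_eq_0 mult.assoc[symmetric])
  next
    case False
    then obtain r where n: "n = Suc (k + r)" using 3(3) less_iff_Suc_add[of k n] by auto
    have r: "n - k = Suc r" "n - Suc k = r" using n by auto
    have IH1: "qbin Q n (Suc k) * qpoch Q (Suc k) * qpoch Q r = qpoch Q n"
      using 3(1) n by auto
    have IH2: "qbin Q n k * qpoch Q k * qpoch Q (Suc r) = qpoch Q n"
      using 3(2) n r by auto
    have "qbin Q (Suc n) (Suc k) * qpoch Q (Suc k) * qpoch Q (Suc n - Suc k)
        = (qbin Q n (Suc k) * qpoch Q (Suc k) * qpoch Q r) * (1 - Q ^ Suc r)
          + Q ^ Suc r * (qbin Q n k * qpoch Q k * qpoch Q (Suc r)) * (1 - Q ^ Suc k)"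
      using r by (simp add: algebra_simps)
    also have "\<dots> = qpoch Q n * (1 - Q ^ (Suc r + Suc k))"
      unfolding IH1 IH2 by (simp add: algebra_simps power_add)
    also have "Suc r + Suc k = Suc n" using n by simp
    finally show ?thesis by simp
  qed
qed auto

lemma triangular_Suc: "Suc k * (Suc k - 1) div 2 = k * (k - 1) div 2 + (k::nat)"
proof -
  have "Suc k * (Suc k - 1) = k * (k - 1) + k * 2" by (cases k) auto
  then show ?thesis by simp
qed

text \<open>The finite q-binomial theorem, with the polynomial variable as z: splitting off the last
  factor reproduces the Pascal rule of \<open>qbin\<close>.\<close>

lemma qbinomial_theorem:
  "coeff (\<Prod>i<n. [:1, r * Q ^ i:]) k = r ^ k * Q ^ (k * (k - 1) div 2) * qbin Q n k"
proof (induction n arbitrary: k)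
  case 0
  then show ?case by (cases k) auto
next
  case (Suc n)
  show ?case
  proof (cases k)
    case 0
    then show ?thesis using Suc.IH[of 0] by (simp add: coeff_mult)
  next
    case [simp]: (Suc l)
    have "coeff (\<Prod>i<Suc n. [:1, r * Q ^ i:]) k
        = coeff (\<Prod>i<n. [:1, r * Q ^ i:]) k + r * Q ^ n * coeff (\<Prod>i<n. [:1, r * Q ^ i:]) l"
      by (simp add: mult.commute[of _ "[:_, _:]"])
    also have "\<dots> = r ^ k * Q ^ (k * (k - 1) div 2) * qbin Q n k
        + r ^ k * (Q ^ (l * (l - 1) div 2) * (Q ^ n * qbin Q n l))"
      unfolding Suc.IH by (simp add: algebra_simps)
    \<comment> \<open>The exponent splits as n = l + (n - l); for l > n both sides are 0.\<close>
    also have "Q ^ n * qbin Q n l = Q ^ l * Q ^ (n - l) * qbin Q n l"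
      by (cases "l \<le> n") (simp_all add: qbin_eq_0 flip: power_add)
    also have "r ^ k * Q ^ (k * (k - 1) div 2) * qbin Q n k
        + r ^ k * (Q ^ (l * (l - 1) div 2) * (Q ^ l * Q ^ (n - l) * qbin Q n l))
        = r ^ k * Q ^ (k * (k - 1) div 2) * qbin Q (Suc n) k"
      unfolding Suc triangular_Suc by (simp add: algebra_simps power_add)
    finally show ?thesis .
  qed
qed

text \<open>Indexing the Cauchy product by the offset \<open>j\<close> from its middle lets the two
  triangular exponents of the q-binomial theorem combine into a quadratic in \<open>j\<close>, the
  exponent of a theta series.\<close>

lemma coeff_mult_centred:
  "coeff (p * r) (2 * N) = (\<Sum>j\<in>{- int N..int N}. coeff p (nat (int N - j)) * coeff r (nat (int N + j)))"
  unfolding coeff_mult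
  by (rule sum.reindex_bij_witness[of _ "\<lambda>j. nat (int N - j)" "\<lambda>i. int N - int i"])
     (auto simp: nat_diff_distrib' nat_add_distrib intro!: arg_cong2[of _ _ _ _ "(*)"] arg_cong[of _ _ "coeff r"])

section \<open>Euler products as limits\<close>

text \<open>Factors beyond the \<open>m\<close>-th leave coefficient \<open>m\<close> unchanged, so
  it is already that of the truncation defining \<open>E\<close>.\<close>

lemma qpoch_X_tendsto: "(\<lambda>n. qpoch (fps_X :: rat fps) n) \<longlonglongrightarrow> E"
proof (rule tendsto_fpsI)
  fix m
  have "qpoch (fps_X :: rat fps) n $ m = E $ m" if "n \<ge> m" for n
    using that
  proof (induction n rule: dec_induct)
    case base
    then show ?case by (simp add: E_def qpoch_def)
  next
    case (step n)
    have "qpoch (fps_X :: rat fps) (Suc n) = qpoch fps_X n - fps_X ^ Suc n * qpoch fps_X n"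
      by (simp add: algebra_simps)
    then show ?case using step by (simp add: fps_X_power_mult_nth del: power_Suc)
  qed
  then show "\<forall>\<^sub>F n in sequentially. qpoch (fps_X :: rat fps) n $ m = E $ m"
    using eventually_sequentially by blast
qed

lemma dil_qpoch: "k \<ge> 1 \<Longrightarrow> dil k (qpoch Q n) = qpoch (dil k Q) n"
  by (simp add: qpoch_def dil_prod dil_diff dil_power)

lemma qpoch_tendsto: "k \<ge> 1 \<Longrightarrow> (\<lambda>n. qpoch (fps_X ^ k) n) \<longlonglongrightarrow> dil k E"
  using tendsto_dil[OF qpoch_X_tendsto, of k] by (simp add: dil_qpoch dil_X)

lemma E_nth_0 [simp]: "E $ 0 = 1"
  by (simp add: E_def)

lemma qpoch_nth_0: "k \<ge> 1 \<Longrightarrow> qpoch (fps_X ^ k :: rat fps) n $ 0 = 1"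
  by (induction n) (auto simp: fps_X_power_iff simp flip: power_mult power_add power_Suc)

lemma filterlim_nat_add_int: "filterlim (\<lambda>N. nat (int N + j)) at_top sequentially"
proof (rule filterlim_at_top_mono[where f = "\<lambda>N. N - nat (- j)"])
  show "filterlim (\<lambda>N. N - nat (- j)) at_top sequentially"
    by (simp add: filterlim_minus_const_nat_at_top)
qed (auto intro!: always_eventually)

text \<open>At a fixed offset \<open>j\<close> from the middle, the numerator and both denominators
  of the quotient form tend to the same Euler product, so one inverse survives.\<close>

lemma qbin_tendsto:
  assumes "k \<ge> 1"
  shows "(\<lambda>N. qbin (fps_X ^ k) (2 * N) (nat (int N + j))) \<longlonglongrightarrow> inverse (dil k E)"
proof -
  let ?P = "qpoch (fps_X ^ k :: rat fps)"
  note lim = qpoch_tendsto[OF assms]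
  have "(\<lambda>N. ?P (2 * N) * inverse (?P (nat (int N + j))) * inverse (?P (nat (int N + (- j)))))
      \<longlonglongrightarrow> dil k E * inverse (dil k E) * inverse (dil k E)"
    by (intro tendsto_fps_mult tendsto_fps_inverse filterlim_compose[OF lim]
        filterlim_nat_add_int mult_nat_left_at_top) (simp_all add: dil_nth_0)
  also have "dil k E * inverse (dil k E) * inverse (dil k E) = inverse (dil k E)"
    by (simp add: dil_nth_0 inverse_mult_eq_1')
  finally show ?thesis
  proof (rule Lim_transform_eventually)
    show "\<forall>\<^sub>F N in sequentially. ?P (2 * N) * inverse (?P (nat (int N + j)))
        * inverse (?P (nat (int N + - j))) = qbin (fps_X ^ k) (2 * N) (nat (int N + j))"
      using eventually_ge_at_top[of "nat \<bar>j\<bar>"]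
    proof eventually_elim
      case (elim N)
      let ?a = "nat (int N + j)" and ?b = "nat (int N + - j)"
      have "2 * N - ?a = ?b" "?a \<le> 2 * N" using elim by auto
      then have "?P (2 * N) = qbin (fps_X ^ k) (2 * N) ?a * ?P ?a * ?P ?b"
        by (metis qbin_qpoch)
      moreover have "?P ?a * inverse (?P ?a) = 1" "?P ?b * inverse (?P ?b) = 1"
        using assms by (auto intro!: inverse_mult_eq_1' simp: qpoch_nth_0)
      moreover have "p * a' * b' = q" if "p = q * a * b" "a * a' = 1" "b * b' = 1"
        for p q a b a' b' :: "rat fps"
      proof -
        have "p * a' * b' = q * (a * a') * (b * b')" unfolding that(1) by (simp only: mult_ac)
        then show ?thesis by (simp add: that)
      qed
      ultimately show ?case by blast
    qed
  qed
qed

section \<open>Theta series\<close>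

text \<open>This stands for the sum of q^(e i) over \<open>S\<close>, encoded by fibre sizes so that
  reindexing becomes a bijection argument. An infinite fibre would count as 0, hence the predicate
  \<open>finite_fibres\<close>.\<close>

definition theta :: "'i set \<Rightarrow> ('i \<Rightarrow> nat) \<Rightarrow> rat fps" where
  "theta S e = Abs_fps (\<lambda>n. of_nat (card {i \<in> S. e i = n}))"

definition finite_fibres :: "'i set \<Rightarrow> ('i \<Rightarrow> nat) \<Rightarrow> bool" where
  "finite_fibres S e \<longleftrightarrow> (\<forall>n. finite {i \<in> S. e i = n})"

lemma theta_nth: "theta S e $ n = of_nat (card {i \<in> S. e i = n})"
  by (simp add: theta_def)

lemma finite_fibres_le:
  assumes "finite_fibres S e"
  shows "finite {i \<in> S. e i \<le> n}"
proof -
  have "{i \<in> S. e i \<le> n} = (\<Union>m\<in>{..n}. {i \<in> S. e i = m})" by auto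
  then show ?thesis using assms by (simp add: finite_fibres_def)
qed

lemma finite_fibres_int:
  assumes "\<And>j. \<bar>j\<bar> \<le> int (e j) + 1"
  shows "finite_fibres S e"
  unfolding finite_fibres_def
proof
  fix n
  have "{j \<in> S. e j = n} \<subseteq> {- (int n + 1)..int n + 1}"
  proof
    fix j assume "j \<in> {j \<in> S. e j = n}"
    then show "j \<in> {- (int n + 1)..int n + 1}" using assms[of j] by auto
  qed
  then show "finite {j \<in> S. e j = n}" using finite_subset by blast
qed

lemma finite_fibres_Times:
  assumes "finite_fibres S e" "finite_fibres T f"
  shows "finite_fibres (S \<times> T) (\<lambda>(i, j). e i + f j)"
  unfolding finite_fibres_def
proof
  fix n
  have "{p \<in> S \<times> T. (\<lambda>(i, j). e i + f j) p = n} \<subseteq> {i \<in> S. e i \<le> n} \<times> {j \<in> T. f j \<le> n}"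
    by auto
  then show "finite {p \<in> S \<times> T. (\<lambda>(i, j). e i + f j) p = n}"
    using finite_fibres_le[OF assms(1)] finite_fibres_le[OF assms(2)] finite_subset by blast
qed

lemma finite_fibres_subset: "finite_fibres T e \<Longrightarrow> S \<subseteq> T \<Longrightarrow> finite_fibres S e"
  unfolding finite_fibres_def
  by (auto intro: finite_subset[of "{i \<in> S. e i = n}" "{i \<in> T. e i = n}" for n])

lemma finite_fibres_mono:
  assumes "finite_fibres S e" "\<And>i. i \<in> S \<Longrightarrow> e i \<le> f i"
  shows "finite_fibres S f"
  unfolding finite_fibres_def
proof
  fix n
  have "{i \<in> S. f i = n} \<subseteq> {i \<in> S. e i \<le> n}" using assms(2) by auto
  then show "finite {i \<in> S. f i = n}"
    using finite_fibres_le[OF assms(1)] finite_subset by blast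
qed

lemma finite_fibres_scale: "k \<ge> 1 \<Longrightarrow> finite_fibres S e \<Longrightarrow> finite_fibres S (\<lambda>i. k * e i)"
  by (erule finite_fibres_mono) (cases k, auto)

lemma theta_bij:
  assumes "bij_betw f S T" "\<And>i. i \<in> S \<Longrightarrow> e' (f i) = e i"
  shows "theta S e = theta T e'"
proof (rule fps_ext)
  fix n
  have "bij_betw f {i \<in> S. e i = n} {i \<in> T. e' i = n}"
    using assms unfolding bij_betw_def inj_on_def by (auto simp: image_iff)
  then show "theta S e $ n = theta T e' $ n"
    by (simp add: theta_nth bij_betw_same_card)
qed

lemma theta_Un:
  assumes "finite_fibres (S \<union> T) e" "S \<inter> T = {}"
  shows "theta (S \<union> T) e = theta S e + theta T e"
proof (rule fps_ext)
  fix n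
  have "{i \<in> S \<union> T. e i = n} = {i \<in> S. e i = n} \<union> {i \<in> T. e i = n}" by auto
  moreover have "finite {i \<in> S. e i = n}" "finite {i \<in> T. e i = n}"
    using assms(1) finite_fibres_subset[of "S \<union> T" e] unfolding finite_fibres_def by blast+
  ultimately show "theta (S \<union> T) e $ n = (theta S e + theta T e) $ n"
    using assms(2) by (simp add: theta_nth) (subst card_Un_disjoint, auto)
qed

lemma theta_shift: "fps_X ^ k * theta S e = theta S (\<lambda>i. e i + k)"
  by (rule fps_ext)
     (auto simp: fps_X_power_mult_nth theta_nth intro!: arg_cong[where f = card])

lemma dil_theta: "k \<ge> 1 \<Longrightarrow> dil k (theta S e) = theta S (\<lambda>i. k * e i)"
  by (rule fps_ext)
     (auto simp: dil_nth theta_nth card_eq_0_iff elim!: dvdE intro!: arg_cong[where f = card])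

lemma theta_mult:
  assumes "finite_fibres S e" "finite_fibres T f"
  shows "theta S e * theta T f = theta (S \<times> T) (\<lambda>(i, j). e i + f j)"
proof (rule fps_ext)
  fix n
  have "{p \<in> S \<times> T. (\<lambda>(i, j). e i + f j) p = n}
      = (\<Union>m\<in>{0..n}. {i \<in> S. e i = m} \<times> {j \<in> T. f j = n - m})"
    by auto
  also have "card \<dots> = (\<Sum>m\<in>{0..n}. card ({i \<in> S. e i = m} \<times> {j \<in> T. f j = n - m}))"
    using assms by (intro card_UN_disjoint) (auto simp: finite_fibres_def)
  finally show "(theta S e * theta T f) $ n = theta (S \<times> T) (\<lambda>(i, j). e i + f j) $ n"
    by (simp add: fps_mult_nth theta_nth card_cartesian_product)
qed

lemma qneg_theta_even: "(\<And>i. i \<in> S \<Longrightarrow> even (e i)) \<Longrightarrow> qneg (theta S e) = theta S e"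
  by (rule fps_ext) (auto simp: qneg_nth theta_nth minus_one_power_iff card_eq_0_iff)

lemma qneg_theta_odd: "(\<And>i. i \<in> S \<Longrightarrow> odd (e i)) \<Longrightarrow> qneg (theta S e) = - theta S e"
  by (rule fps_ext) (auto simp: qneg_nth theta_nth minus_one_power_iff card_eq_0_iff)

text \<open>Termwise passage to the limit: only the finitely many \<open>i\<close> with
  \<open>e i \<le> n\<close> reach coefficient \<open>n\<close>, and eventually all of them lie in
  \<open>S N\<close> with stable low coefficients of \<open>c N i\<close>. The scalar
  \<open>s\<close> provides alternating signs.\<close>

lemma theta_tendsto:
  fixes e :: "'i \<Rightarrow> nat" and c :: "nat \<Rightarrow> 'i \<Rightarrow> rat fps" and s :: rat
  assumes fib: "finite_fibres UNIV e"
    and fin: "\<And>N. finite (S N)"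
    and S: "\<And>i. \<forall>\<^sub>F N in sequentially. i \<in> S N"
    and lim: "\<And>i. (\<lambda>N. c N i) \<longlonglongrightarrow> C"
  shows "(\<lambda>N. \<Sum>i\<in>S N. c N i * (fps_const s * fps_X) ^ e i)
           \<longlonglongrightarrow> C * fps_compose (theta UNIV e) (fps_const s * fps_X)"
proof (rule tendsto_fpsI)
  fix n
  let ?I = "{i. e i \<le> n}"
  have finI: "finite ?I" using finite_fibres_le[OF fib] by simp
  have term_nth: "(c N i * (fps_const s * fps_X) ^ e i) $ n
      = (if e i \<le> n then s ^ e i * c N i $ (n - e i) else 0)" for N i
    by (simp add: power_mult_distrib mult.left_commute[of "c N i"] fps_const_power
        fps_X_power_mult_right_nth)
  have "(C * fps_compose (theta UNIV e) (fps_const s * fps_X)) $ n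
      = (\<Sum>m\<in>{0..n}. of_nat (card {i. e i = m}) * (s ^ m * C $ (n - m)))"
    unfolding mult.commute[of C] fps_mult_nth fps_nth_compose_linear theta_nth
    by (simp add: mult.assoc mult.left_commute[of "s ^ _"])
  also have "\<dots> = (\<Sum>m\<in>{0..n}. \<Sum>i\<in>{i \<in> ?I. e i = m}. s ^ e i * C $ (n - e i))"
    by (auto intro!: sum.cong arg_cong[where f = card])
  also have "\<dots> = (\<Sum>i\<in>?I. s ^ e i * C $ (n - e i))"
    using finI by (intro sum.group) auto
  finally have rhs: "(C * fps_compose (theta UNIV e) (fps_const s * fps_X)) $ n
      = (\<Sum>i\<in>?I. s ^ e i * C $ (n - e i))" .
  have "\<forall>\<^sub>F N in sequentially. \<forall>i\<in>?I. i \<in> S N"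
    using S finI by (intro eventually_ball_finite) auto
  moreover have "\<forall>\<^sub>F N in sequentially. \<forall>i\<in>?I. \<forall>m\<in>{0..n}. c N i $ m = C $ m"
    using lim finI by (intro eventually_ball_finite ballI) (auto simp: tendsto_fps_iff)
  ultimately show "\<forall>\<^sub>F N in sequentially. (\<Sum>i\<in>S N. c N i * (fps_const s * fps_X) ^ e i) $ n
      = (C * fps_compose (theta UNIV e) (fps_const s * fps_X)) $ n"
  proof eventually_elim
    case (elim N)
    have "(\<Sum>i\<in>S N. c N i * (fps_const s * fps_X) ^ e i) $ n
        = (\<Sum>i\<in>S N. if e i \<le> n then s ^ e i * c N i $ (n - e i) else 0)"
      unfolding fps_sum_nth term_nth ..
    also have "\<dots> = (\<Sum>i\<in>?I. s ^ e i * C $ (n - e i))"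
      using elim fin by (intro sum.mono_neutral_cong_right) auto
    finally show ?case using rhs by simp
  qed
qed

section \<open>The theta functions of Ramanujan\<close>

definition phi :: "rat fps" where
  "phi = theta UNIV (\<lambda>j::int. nat (j\<^sup>2))"

text \<open>Ramanujan's sum of q^(n(n+1)/2) over n >= 0: as \<open>j\<close> runs over the integers,
  2j^2 + j meets every triangular number exactly once.\<close>

definition psi :: "rat fps" where
  "psi = theta UNIV (\<lambda>j::int. nat (2 * j\<^sup>2 + j))"

lemma abs_le_square_int: "\<bar>j\<bar> \<le> j\<^sup>2" for j :: int
  by (metis abs_le_square_iff abs_ge_zero int_one_le_iff_zero_less power2_abs power2_eq_square
      mult_le_cancel_left1 mult_zero_left order.refl zero_less_abs_iff not_less)

lemma finite_fibres_square: "finite_fibres S (\<lambda>j::int. nat (j\<^sup>2))"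
proof (rule finite_fibres_int)
  show "\<bar>j\<bar> \<le> int (nat (j\<^sup>2)) + 1" for j :: int
    using abs_le_square_int[of j] by simp
qed

lemma finite_fibres_psi: "finite_fibres S (\<lambda>j::int. nat (2 * j\<^sup>2 + j))"
proof (rule finite_fibres_int)
  show "\<bar>j\<bar> \<le> int (nat (2 * j\<^sup>2 + j)) + 1" for j :: int
    using abs_le_square_int[of j] by linarith
qed

section \<open>Product formulas for phi and psi as limits of finite identities\<close>

lemma coeff_prod_in_square:
  "coeff (\<Prod>i<n. [:1, 0, f i:]) (2 * k) = coeff (\<Prod>i<n. [:1, f i:]) k"
  for f :: "nat \<Rightarrow> 'a::comm_ring_1"
proof -
  have *: "coeff (pcompose p [:0, 0, 1:]) (2 * k) = coeff p k" for p :: "'a poly" and k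
  proof (induction p arbitrary: k)
    case (pCons a p)
    show ?case
    proof (cases k)
      case [simp]: (Suc l)
      show ?thesis using pCons.IH[of l] by (simp add: pcompose_pCons)
    qed (simp add: pcompose_pCons)
  qed simp
  have "(\<Prod>i<n. [:1, 0, f i:]) = pcompose (\<Prod>i<n. [:1, f i:]) [:0, 0, 1:]"
    by (simp add: pcompose_prod pcompose_pCons)
  then show ?thesis by (simp add: *)
qed

lemma twice_triangular: "2 * (a * (a - 1) div 2) = a * (a - 1)" for a :: nat
  by (cases a) simp_all

text \<open>The terms linear in \<open>j\<close> cancel between the offsets -j and j; this is where
  the exponent j^2 comes from.\<close>

lemma triangular_centred:
  fixes N a b :: nat and j :: int
  assumes "int a = int N - j" "int b = int N + j"
  shows "a * (a - 1) div 2 + b * (b - 1) div 2 = N * (N - 1) + nat (j\<^sup>2)"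
proof -
  have tri: "2 * int (a * (a - 1) div 2) = int a * (int a - 1)" for a :: nat
  proof -
    have "2 * int (a * (a - 1) div 2) = int (a * (a - 1))"
      using twice_triangular[of a] by (metis of_nat_mult of_nat_numeral)
    then show ?thesis by (cases a) (simp_all add: algebra_simps)
  qed
  have N: "int (N * (N - 1)) = int N * (int N - 1)" by (cases N) (simp_all add: algebra_simps)
  have "2 * int (a * (a - 1) div 2 + b * (b - 1) div 2) = 2 * int (N * (N - 1) + nat (j\<^sup>2))"
    using tri[of a] tri[of b] unfolding assms of_nat_add N
    by (simp add: algebra_simps power2_eq_square)
  moreover have "2 * int x = 2 * int y \<Longrightarrow> x = y" for x y by simp
  ultimately show ?thesis by blast
qed

lemma eventually_centred: "\<forall>\<^sub>F N in sequentially. j \<in> {- int N..int N}"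
  using eventually_ge_at_top[of "nat \<bar>j\<bar>"] by eventually_elim auto

text \<open>Comparing the coefficients of \<open>z^(2N)\<close> in
  \<open>\<Prod>(1 + z q^i) (1 - z q^i) = \<Prod>(1 - z^2 q^(2i))\<close>, where \<open>i < 2N\<close>.\<close>
lemma phi_finite:
  "qbin (fps_X ^ 2) (2 * N) N
    = (\<Sum>j\<in>{- int N..int N}. qbin fps_X (2 * N) (nat (int N - j)) * qbin fps_X (2 * N) (nat (int N + j))
        * (fps_const (- 1) * fps_X) ^ nat (j\<^sup>2) :: rat fps)" (is "?L = ?R")
proof -
  let ?X = "fps_X :: rat fps"
  let ?q = "qbin ?X (2 * N)"
  let ?p = "\<lambda>r. \<Prod>i<2 * N. [:1, r * ?X ^ i:]"
  have "?p 1 * ?p (- 1) = (\<Prod>i<2 * N. [:1, 0, (- 1) * (?X ^ 2) ^ i:])"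
    unfolding prod.distrib[symmetric] by (rule prod.cong) (simp_all flip: power_mult power_add add: mult_2)
  then have "coeff (?p 1 * ?p (- 1)) (2 * N) = (- 1) ^ N * (?X ^ 2) ^ (N * (N - 1) div 2) * qbin (?X ^ 2) (2 * N) N"
    by (simp only: coeff_prod_in_square qbinomial_theorem)
  also have "(?X ^ 2) ^ (N * (N - 1) div 2) = ?X ^ (N * (N - 1))"
    unfolding power_mult[symmetric] twice_triangular ..
  finally have L: "coeff (?p 1 * ?p (- 1)) (2 * N) = (- 1) ^ N * ?X ^ (N * (N - 1)) * ?L" .
  have "coeff (?p 1 * ?p (- 1)) (2 * N) = (\<Sum>j\<in>{- int N..int N}.
      (- 1) ^ N * ?X ^ (N * (N - 1)) * (?q (nat (int N - j)) * ?q (nat (int N + j)) * (fps_const (- 1) * ?X) ^ nat (j\<^sup>2)))"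
    unfolding coeff_mult_centred qbinomial_theorem
  proof (rule sum.cong[OF refl])
    fix j assume j: "j \<in> {- int N..int N}"
    define a b where "a = nat (int N - j)" and "b = nat (int N + j)"
    have ab: "int a = int N - j" "int b = int N + j" using j by (auto simp: a_def b_def)
    \<comment> \<open>Since j and j^2 have the same parity, (-1)^b is (-1)^N times (-1)^(j^2), and
      the second sign is absorbed by replacing q with -q.\<close>
    have "even b \<longleftrightarrow> even (int N + j)" using ab by presburger
    also have "\<dots> \<longleftrightarrow> even (N + nat (j\<^sup>2))"
      by (metis even_add even_of_nat even_power pos2 zero_le_power2 int_nat_eq of_nat_add)
    finally have "(- 1 :: rat fps) ^ b = (- 1) ^ (N + nat (j\<^sup>2))"
      by (simp add: minus_one_power_iff)
    moreover have "?X ^ (a * (a - 1) div 2) * ?X ^ (b * (b - 1) div 2) = ?X ^ (N * (N - 1)) * ?X ^ nat (j\<^sup>2)"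
      using triangular_centred[OF ab] by (simp flip: power_add)
    moreover have "(fps_const (- 1) * ?X) ^ nat (j\<^sup>2) = (- 1) ^ nat (j\<^sup>2) * ?X ^ nat (j\<^sup>2)"
      by (metis fps_const_neg fps_const_1_eq_1 power_mult_distrib)
    ultimately show "1 ^ a * ?X ^ (a * (a - 1) div 2) * ?q a * ((- 1) ^ b * ?X ^ (b * (b - 1) div 2) * ?q b)
      = (- 1) ^ N * ?X ^ (N * (N - 1)) * (?q a * ?q b * (fps_const (- 1) * ?X) ^ nat (j\<^sup>2))"
      by (simp add: power_add mult_ac)
  qed
  also have "\<dots> = (- 1) ^ N * ?X ^ (N * (N - 1)) * ?R"
    by (simp only: sum_distrib_left)
  finally show ?thesis using L by simp
qed

text \<open>Gauss's product phi(-q) = E(q)^2 / E(q^2), the limit of \<open>phi_finite\<close> as N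
  grows: each Gaussian binomial tends to an inverse Euler product.\<close>

lemma phi_product: "E ^ 2 = dil 2 E * qneg phi"
proof -
  let ?iE = "inverse E"
  have "(\<lambda>N. qbin (fps_X ^ 2) (2 * N) (nat (int N + 0))) \<longlonglongrightarrow> inverse (dil 2 E)"
    by (rule qbin_tendsto) simp
  moreover have "(\<lambda>N. \<Sum>j\<in>{- int N..int N}. qbin fps_X (2 * N) (nat (int N - j)) * qbin fps_X (2 * N) (nat (int N + j))
        * (fps_const (- 1) * fps_X) ^ nat (j\<^sup>2) :: rat fps)
      \<longlonglongrightarrow> ?iE * ?iE * fps_compose (theta UNIV (\<lambda>j::int. nat (j\<^sup>2))) (fps_const (- 1) * fps_X)"
    using qbin_tendsto[of 1 "_ :: int"] qbin_tendsto[of 1 "- _ :: int"]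
    by (intro theta_tendsto tendsto_fps_mult eventually_centred finite_fibres_square) simp_all
  ultimately have "inverse (dil 2 E) = ?iE * ?iE * fps_compose phi (fps_const (- 1) * fps_X)"
    unfolding phi_def phi_finite[symmetric] by (simp add: LIMSEQ_unique)
  also have "fps_compose phi (fps_const (- 1) * fps_X) = qneg phi"
    by (rule fps_ext) (simp add: qneg_nth)
  finally have "inverse (dil 2 E) * dil 2 E * E ^ 2 = (?iE * E) * (?iE * E) * dil 2 E * qneg phi"
    by (simp add: power2_eq_square mult_ac)
  then show ?thesis by (simp add: inverse_mult_eq_1 dil_nth_0)
qed

text \<open>Comparing the coefficients of \<open>z^(2N)\<close> in
  \<open>\<Prod>(1 + z q^i) = \<Prod>(1 + z q^(2i)) \<Prod>(1 + z q^(2i+1))\<close>, where \<open>i < 4N\<close> on the left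
  and \<open>i < 2N\<close> on the right.\<close>
lemma psi_finite:
  "qbin fps_X (2 * (2 * N)) (2 * N)
    = (\<Sum>j\<in>{- int N..int N}. qbin (fps_X ^ 2) (2 * N) (nat (int N - j)) * qbin (fps_X ^ 2) (2 * N) (nat (int N + j))
        * (fps_const 1 * fps_X) ^ nat (2 * j\<^sup>2 + j) :: rat fps)" (is "?L = ?R")
proof -
  let ?X = "fps_X :: rat fps"
  let ?q = "qbin (?X ^ 2) (2 * N)"
  let ?p = "\<lambda>r. \<Prod>i<2 * N. [:1, r * (?X ^ 2) ^ i:]"
  have "(\<Prod>i<2 * M. [:1, 1 * ?X ^ i:]) = (\<Prod>i<M. [:1, 1 * (?X ^ 2) ^ i:]) * (\<Prod>i<M. [:1, ?X * (?X ^ 2) ^ i:])" for M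
  proof (induction M)
    case (Suc M)
    have "2 * Suc M = Suc (Suc (2 * M))" by simp
    moreover have "?X ^ (2 * M) = (?X ^ 2) ^ M" "1 * ?X ^ Suc (2 * M) = ?X * (?X ^ 2) ^ M"
      by (simp_all add: power_mult)
    ultimately show ?case
      by (simp only: prod.lessThan_Suc Suc.IH) (simp only: mult_ac)
  qed simp
  then have "coeff (?p 1 * ?p ?X) (2 * N) = coeff (\<Prod>i<2 * (2 * N). [:1, 1 * ?X ^ i:]) (2 * N)"
    by (simp only:)
  also have "\<dots> = ?X ^ (2 * N * (2 * N - 1) div 2) * ?L"
    unfolding qbinomial_theorem by simp
  also have "2 * N * (2 * N - 1) div 2 = 2 * (N * (N - 1)) + N"
    by (cases N) simp_all
  finally have L: "coeff (?p 1 * ?p ?X) (2 * N) = ?X ^ (2 * (N * (N - 1)) + N) * ?L" .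
  have "coeff (?p 1 * ?p ?X) (2 * N) = (\<Sum>j\<in>{- int N..int N}. ?X ^ (2 * (N * (N - 1)) + N)
      * (?q (nat (int N - j)) * ?q (nat (int N + j)) * (fps_const 1 * ?X) ^ nat (2 * j\<^sup>2 + j)))"
    unfolding coeff_mult_centred qbinomial_theorem
  proof (rule sum.cong[OF refl])
    fix j assume j: "j \<in> {- int N..int N}"
    define a b where "a = nat (int N - j)" and "b = nat (int N + j)"
    have ab: "int a = int N - j" "int b = int N + j" using j by (auto simp: a_def b_def)
    \<comment> \<open>The base X^2 doubles both triangular exponents, and X^b, coming from the odd
      powers, adds N + j.\<close>
    have "2 * (a * (a - 1) div 2) + (b + 2 * (b * (b - 1) div 2)) = 2 * (N * (N - 1)) + N + nat (2 * j\<^sup>2 + j)"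
      using triangular_centred[OF ab] ab(2) abs_le_square_int[of j] by linarith
    then have "?X ^ (2 * (a * (a - 1) div 2)) * (?X ^ b * ?X ^ (2 * (b * (b - 1) div 2)))
        = ?X ^ (2 * (N * (N - 1)) + N) * ?X ^ nat (2 * j\<^sup>2 + j)"
      by (simp only: flip: power_add)
    note exponents = this
    have "1 ^ a * (?X ^ 2) ^ (a * (a - 1) div 2) * ?q a * (?X ^ b * (?X ^ 2) ^ (b * (b - 1) div 2) * ?q b)
        = ?X ^ (2 * (a * (a - 1) div 2)) * (?X ^ b * ?X ^ (2 * (b * (b - 1) div 2))) * (?q a * ?q b)"
      by (simp only: power_mult[symmetric] power_one mult_1) (simp only: mult_ac)
    also have "\<dots> = ?X ^ (2 * (N * (N - 1)) + N) * (?q a * ?q b * ?X ^ nat (2 * j\<^sup>2 + j))"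
      by (simp only: exponents) (simp only: mult_ac)
    finally show "1 ^ a * (?X ^ 2) ^ (a * (a - 1) div 2) * ?q a * (?X ^ b * (?X ^ 2) ^ (b * (b - 1) div 2) * ?q b)
      = ?X ^ (2 * (N * (N - 1)) + N) * (?q a * ?q b * (fps_const 1 * ?X) ^ nat (2 * j\<^sup>2 + j))"
      by (simp only: fps_const_1_eq_1 mult_1)
  qed
  also have "\<dots> = ?X ^ (2 * (N * (N - 1)) + N) * ?R"
    by (simp only: sum_distrib_left)
  finally show ?thesis using L by simp
qed

text \<open>Gauss's product psi(q) = E(q^2)^2 / E(q), the limit of
  \<open>psi_finite\<close>.\<close>

lemma psi_product: "dil 2 E ^ 2 = E * psi"
proof -
  let ?i2 = "inverse (dil 2 E)"
  have "(\<lambda>N. qbin (fps_X ^ 1) (2 * N) (nat (int N + 0))) \<longlonglongrightarrow> inverse (dil 1 E)"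
    by (rule qbin_tendsto) simp
  then have "(\<lambda>N. qbin fps_X (2 * N) N) \<longlonglongrightarrow> inverse E" by simp
  then have "(\<lambda>N. qbin fps_X (2 * (2 * N)) (2 * N)) \<longlonglongrightarrow> inverse E"
    by (rule filterlim_compose) (rule mult_nat_left_at_top, simp)
  moreover have "(\<lambda>N. \<Sum>j\<in>{- int N..int N}. qbin (fps_X ^ 2) (2 * N) (nat (int N - j)) * qbin (fps_X ^ 2) (2 * N) (nat (int N + j))
        * (fps_const 1 * fps_X) ^ nat (2 * j\<^sup>2 + j) :: rat fps)
      \<longlonglongrightarrow> ?i2 * ?i2 * fps_compose (theta UNIV (\<lambda>j::int. nat (2 * j\<^sup>2 + j))) (fps_const 1 * fps_X)"
    using qbin_tendsto[of 2 "_ :: int"] qbin_tendsto[of 2 "- _ :: int"]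
    by (intro theta_tendsto tendsto_fps_mult eventually_centred finite_fibres_psi) simp_all
  ultimately have "inverse E = ?i2 * ?i2 * psi"
    unfolding psi_def psi_finite[symmetric] by (simp add: LIMSEQ_unique)
  then have "inverse E * E * dil 2 E ^ 2 = (?i2 * dil 2 E) * (?i2 * dil 2 E) * E * psi"
    by (simp add: power2_eq_square mult_ac)
  then show ?thesis by (simp add: inverse_mult_eq_1 dil_nth_0)
qed

text \<open>Even factors occur squared and give E(q^2)^2; each odd pair (1 - q^m)(1 + q^m) is 1 -
  q^(2m), and together these give E(q^2) / E(q^4). The finite version goes by induction.\<close>

lemma qneg_E: "E * qneg E * dil 4 E = dil 2 E ^ 3"
proof -
  let ?X = "fps_X :: rat fps"
  have fin: "qpoch ?X (2 * N) * qpoch (- ?X) (2 * N) * qpoch (?X ^ 4) N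
      = qpoch (?X ^ 2) N * qpoch (?X ^ 2) N * qpoch (?X ^ 2) (2 * N)" for N
  proof (induction N)
    case (Suc N)
    \<comment> \<open>The induction step adds the odd power \<open>?Y\<close> and the even power X
      \<open>?Y\<close> = X^(2N+2).\<close>
    let ?Y = "?X ^ (2 * N + 1)"
    have e0: "(?X ^ 4) ^ Suc N = (?X * ?Y)\<^sup>2"
      unfolding power_Suc[symmetric] power_mult[symmetric] by (rule arg_cong[where f = "power ?X"]) simp
    have e1: "qpoch ?X (2 * Suc N) = qpoch ?X (2 * N) * (1 - ?Y) * (1 - ?X * ?Y)"
      and e2: "qpoch (- ?X) (2 * Suc N) = qpoch (- ?X) (2 * N) * (1 + ?Y) * (1 - ?X * ?Y)"
      by (simp_all flip: power_mult power_Suc add: algebra_simps power_mult_distrib power_add)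
    have e3: "qpoch (?X ^ 4) (Suc N) = qpoch (?X ^ 4) N * (1 - (?X * ?Y)\<^sup>2)"
      unfolding qpoch_Suc e0 ..
    have e4: "qpoch (?X ^ 2) (Suc N) = qpoch (?X ^ 2) N * (1 - ?X * ?Y)"
      and e5: "qpoch (?X ^ 2) (2 * Suc N) = qpoch (?X ^ 2) (2 * N) * (1 - ?Y\<^sup>2) * (1 - (?X * ?Y)\<^sup>2)"
      by (simp_all flip: power_mult power_Suc add: algebra_simps power_mult_distrib power_add)
    have "qpoch ?X (2 * Suc N) * qpoch (- ?X) (2 * Suc N) * qpoch (?X ^ 4) (Suc N)
      = (qpoch ?X (2 * N) * qpoch (- ?X) (2 * N) * qpoch (?X ^ 4) N)
        * ((1 - ?Y) * (1 + ?Y) * (1 - ?X * ?Y) * (1 - ?X * ?Y) * (1 - (?X * ?Y)\<^sup>2))"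
      unfolding e1 e2 e3 by (simp only: mult_ac)
    also have "(1 - ?Y) * (1 + ?Y) = 1 - ?Y\<^sup>2"
      by (simp add: algebra_simps power2_eq_square)
    finally show ?case unfolding Suc.IH e4 e5 by (simp only: mult_ac)
  qed simp
  have dbl: "filterlim (\<lambda>N. 2 * N) at_top (sequentially :: nat filter)"
    by (rule mult_nat_left_at_top) simp
  have neg: "(\<lambda>n. qpoch (- ?X) n) \<longlonglongrightarrow> qneg E"
  proof (rule tendsto_fpsI)
    fix n
    have "\<forall>\<^sub>F N in sequentially. qpoch ?X N $ n = E $ n"
      using qpoch_X_tendsto by (simp add: tendsto_fps_iff)
    moreover have "qpoch (- ?X) N = qneg (qpoch ?X N)" for N
      by (induction N) (simp_all add: qneg_mult qneg_diff qneg_power qneg_X del: power_Suc)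
    ultimately show "\<forall>\<^sub>F N in sequentially. qpoch (- ?X) N $ n = qneg E $ n"
      by (simp add: qneg_nth eventually_mono)
  qed
  have "(\<lambda>N. qpoch ?X (2 * N) * qpoch (- ?X) (2 * N) * qpoch (?X ^ 4) N) \<longlonglongrightarrow> E * qneg E * dil 4 E"
    by (intro tendsto_fps_mult filterlim_compose[OF qpoch_X_tendsto dbl] filterlim_compose[OF neg dbl] qpoch_tendsto) simp
  moreover have "(\<lambda>N. qpoch (?X ^ 2) N * qpoch (?X ^ 2) N * qpoch (?X ^ 2) (2 * N)) \<longlonglongrightarrow> dil 2 E * dil 2 E * dil 2 E"
    by (intro tendsto_fps_mult filterlim_compose[OF qpoch_tendsto dbl] qpoch_tendsto) simp_all
  ultimately show ?thesis
    unfolding fin by (simp add: LIMSEQ_unique power3_eq_cube)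
qed

section \<open>Lattice sums for the forms m^2 + n^2 and m^2 + 3n^2\<close>

definition triang :: "rat fps" where
  "triang = theta UNIV (\<lambda>j::int. nat (j * (j + 1)))"

lemma consecutive_nonneg: "0 \<le> j * (j + 1)" for j :: int
  by (cases "j \<ge> 0") (auto intro: mult_nonpos_nonpos)

lemma finite_fibres_triang: "finite_fibres S (\<lambda>j::int. nat (j * (j + 1)))"
proof (rule finite_fibres_int)
  fix j :: int
  have "j * (j + 1) = (j + 1)\<^sup>2 - (j + 1)" "j * (j + 1) = j\<^sup>2 + j"
    by (simp_all add: power2_eq_square algebra_simps)
  then have "\<bar>j\<bar> \<le> j * (j + 1) + 1"
    using abs_le_square_int[of j] abs_le_square_int[of "j + 1"] by linarith
  then show "\<bar>j\<bar> \<le> int (nat (j * (j + 1))) + 1" using consecutive_nonneg[of j] by simp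
qed

text \<open>Both j = 2k and j = -1 - 2k give j(j+1) = 2(2k^2 + k), so the even and the odd indices
  contribute equally.\<close>

lemma triang_eq: "triang = 2 * dil 2 psi"
proof -
  let ?e = "\<lambda>j::int. nat (j * (j + 1))" and ?f = "\<lambda>j::int. 2 * nat (2 * j\<^sup>2 + j)"
  have "triang = theta ({j. even j} \<union> {j. odd j}) ?e"
    unfolding triang_def by (rule arg_cong[where f = "\<lambda>S. theta S ?e"]) auto
  also have "\<dots> = theta {j. even j} ?e + theta {j. odd j} ?e"
    by (intro theta_Un finite_fibres_triang) auto
  also have "theta {j. even j} ?e = theta UNIV ?f"
    by (rule theta_bij[symmetric, where f = "\<lambda>j. 2 * j"])
       (auto intro!: bij_betw_byWitness[where f' = "\<lambda>j. j div 2"]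
          simp: nat_mult_distrib[symmetric] power2_eq_square algebra_simps simp flip: nat_mult_distrib)
  also have "theta {j. odd j} ?e = theta UNIV ?f"
    by (rule theta_bij[symmetric, where f = "\<lambda>j. - 1 - 2 * j"])
       (auto intro!: bij_betw_byWitness[where f' = "\<lambda>j. (- 1 - j) div 2"]
          simp: power2_eq_square algebra_simps elim!: oddE)
  also have "theta UNIV ?f = dil 2 psi"
    by (simp add: psi_def dil_theta)
  finally show ?thesis by simp
qed

abbreviation odd_pairs :: "(int \<times> int) set" where
  "odd_pairs \<equiv> {(m, n). odd (m + n)}"

abbreviation even_pairs :: "(int \<times> int) set" where
  "even_pairs \<equiv> {(m, n). even (m + n)}"

lemma theta_int_pairs:
  assumes "finite_fibres (UNIV :: (int \<times> int) set) e"
  shows "theta UNIV e = theta even_pairs e + theta odd_pairs e"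
proof -
  have "theta UNIV e = theta (even_pairs \<union> odd_pairs) e"
    by (rule arg_cong[where f = "\<lambda>S. theta S e"]) auto
  also have "\<dots> = theta even_pairs e + theta odd_pairs e"
    using assms by (intro theta_Un finite_fibres_subset[OF assms]) auto
  finally show ?thesis .
qed

text \<open>The plane lattice splits by the parity of m + n, and the rotation (a, b) -> (a + b, a -
  b), shifted by 1 for the odd class, parametrizes each class by all integer pairs.\<close>

lemma phi_square: "phi ^ 2 = dil 2 phi ^ 2 + fps_X * dil 2 triang ^ 2"
proof -
  let ?e = "\<lambda>(m::int, n::int). nat (m\<^sup>2) + nat (n\<^sup>2)"
  have fin: "finite_fibres UNIV ?e"
    using finite_fibres_Times[OF finite_fibres_square finite_fibres_square, of UNIV UNIV] by simp
  have "phi ^ 2 = theta UNIV ?e"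
    unfolding power2_eq_square[of phi] unfolding phi_def
    by (subst theta_mult) (simp_all add: finite_fibres_square)
  also have "\<dots> = theta even_pairs ?e + theta odd_pairs ?e"
    by (rule theta_int_pairs[OF fin])
  also have "theta even_pairs ?e = theta UNIV (\<lambda>(a::int, b::int). 2 * nat (a\<^sup>2) + 2 * nat (b\<^sup>2))"
  proof (rule theta_bij[symmetric, where f = "\<lambda>(a, b). (a + b, a - b)"])
    show "bij_betw (\<lambda>(a, b). (a + b, a - b)) UNIV even_pairs"
      by (rule bij_betw_byWitness[where f' = "\<lambda>(m, n). ((m + n) div 2, (m - n) div 2)"]) (auto, presburger+)
    show "?e ((\<lambda>(a, b). (a + b, a - b)) p) = (\<lambda>(a::int, b::int). 2 * nat (a\<^sup>2) + 2 * nat (b\<^sup>2)) p" for p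
    proof -
      obtain a b where p: "p = (a, b)" by (cases p)
      have "(a + b)\<^sup>2 + (a - b)\<^sup>2 = 2 * a\<^sup>2 + 2 * b\<^sup>2"
        by (simp add: power2_eq_square algebra_simps)
      then have "int (nat ((a + b)\<^sup>2) + nat ((a - b)\<^sup>2)) = int (2 * nat (a\<^sup>2) + 2 * nat (b\<^sup>2))" by simp
      then show ?thesis unfolding p by (simp only: of_nat_eq_iff prod.case)
    qed
  qed
  also have "\<dots> = dil 2 phi ^ 2"
    unfolding power2_eq_square[of "dil 2 phi"] unfolding phi_def
    by (simp only: dil_theta one_le_numeral, subst theta_mult)
       (simp_all add: finite_fibres_scale finite_fibres_square)
  also have "theta odd_pairs ?e = theta UNIV (\<lambda>(a::int, b::int). 2 * nat (a * (a + 1)) + 2 * nat (b * (b + 1)) + 1)"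
  proof (rule theta_bij[symmetric, where f = "\<lambda>(a, b). (a + b + 1, a - b)"])
    show "bij_betw (\<lambda>(a, b). (a + b + 1, a - b)) UNIV odd_pairs"
      by (rule bij_betw_byWitness[where f' = "\<lambda>(m, n). ((m + n) div 2, (m - n) div 2)"]) (auto simp: algebra_simps elim!: oddE)
    show "?e ((\<lambda>(a, b). (a + b + 1, a - b)) p) = (\<lambda>(a::int, b::int). 2 * nat (a * (a + 1)) + 2 * nat (b * (b + 1)) + 1) p" for p
    proof -
      obtain a b where p: "p = (a, b)" by (cases p)
      have "(a + b + 1)\<^sup>2 + (a - b)\<^sup>2 = 2 * (a * (a + 1)) + 2 * (b * (b + 1)) + 1"
        by (simp add: power2_eq_square algebra_simps)
      then have "int (nat ((a + b + 1)\<^sup>2) + nat ((a - b)\<^sup>2)) = int (2 * nat (a * (a + 1)) + 2 * nat (b * (b + 1)) + 1)"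
        using consecutive_nonneg by simp
      then show ?thesis unfolding p by (simp only: of_nat_eq_iff prod.case)
    qed
  qed
  also have "\<dots> = fps_X ^ 1 * dil 2 triang ^ 2"
    unfolding power2_eq_square[of "dil 2 triang"] unfolding triang_def
    by (simp only: dil_theta one_le_numeral, subst theta_mult)
       (simp_all add: finite_fibres_scale finite_fibres_triang theta_shift[of 1, simplified] split_def)
  finally show ?thesis by simp
qed


text \<open>As m^2 + 3n^2 has the parity of m + n, the left side is twice the sum over odd pairs. On
  the right, a(a+1) + 3b(b+1) + 1 is the same form at the half-integers a + 1/2, b + 1/2, and a unit
  of the Eisenstein integers matches the two sums.\<close>

lemma phi_phi3: "phi * dil 3 phi - qneg (phi * dil 3 phi) = 4 * fps_X * dil 2 psi * dil 6 psi"
proof -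
  let ?e = "\<lambda>(m::int, n::int). nat (m\<^sup>2) + 3 * nat (n\<^sup>2)"
  let ?f = "\<lambda>(a::int, b::int). nat (a * (a + 1)) + 3 * nat (b * (b + 1)) + 1"
  have fin3: "finite_fibres UNIV (\<lambda>j::int. 3 * nat (j\<^sup>2))" "finite_fibres UNIV (\<lambda>j::int. 3 * nat (j * (j + 1)))"
    by (simp_all only: finite_fibres_scale finite_fibres_square finite_fibres_triang one_le_numeral)
  have fine: "finite_fibres UNIV ?e"
    using finite_fibres_Times[OF finite_fibres_square fin3(1), of UNIV] by simp
  have finf: "finite_fibres UNIV ?f"
  proof (rule finite_fibres_mono)
    show "finite_fibres UNIV (\<lambda>(a::int, b::int). nat (a * (a + 1)) + 3 * nat (b * (b + 1)))"
      using finite_fibres_Times[OF finite_fibres_triang fin3(2), of UNIV] by simp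
  qed auto
  have "phi * dil 3 phi = theta UNIV ?e"
    unfolding phi_def by (simp add: dil_theta, subst theta_mult) (simp_all add: finite_fibres_square fin3)
  also have "\<dots> = theta even_pairs ?e + theta odd_pairs ?e"
    by (rule theta_int_pairs[OF fine])
  finally have phis: "phi * dil 3 phi = theta even_pairs ?e + theta odd_pairs ?e" .
  have "qneg (theta even_pairs ?e) = theta even_pairs ?e"
    by (rule qneg_theta_even) (auto simp: even_nat_iff)
  moreover have "qneg (theta odd_pairs ?e) = - theta odd_pairs ?e"
    by (rule qneg_theta_odd) (auto simp: even_nat_iff)
  ultimately have L: "phi * dil 3 phi - qneg (phi * dil 3 phi) = 2 * theta odd_pairs ?e"
    unfolding phis qneg_add by simp
  have "triang * dil 3 triang = theta UNIV (\<lambda>(a::int, b::int). nat (a * (a + 1)) + 3 * nat (b * (b + 1)))"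
    unfolding triang_def by (simp only: dil_theta one_le_numeral, subst theta_mult) (simp_all add: finite_fibres_triang fin3)
  then have "fps_X * (triang * dil 3 triang) = theta UNIV ?f"
    using theta_shift[of 1] by (simp add: split_def)
  also have "\<dots> = theta even_pairs ?f + theta odd_pairs ?f"
    by (rule theta_int_pairs[OF finf])
  \<comment> \<open>The reflection b -> -1 - b preserves b(b+1) and flips the parity of a +
    b.\<close>
  also have "theta even_pairs ?f = theta odd_pairs ?f"
    by (rule theta_bij[where f = "\<lambda>(a, b). (a, - 1 - b)"])
       (auto intro!: bij_betw_byWitness[where f' = "\<lambda>(a, b). (a, - 1 - b)"] simp: algebra_simps)
  also have "theta odd_pairs ?f = theta odd_pairs ?e"
  proof -
    \<comment> \<open>With z = (a + 1/2) + (b + 1/2) sqrt(-3), \<open>?F\<close> is multiplication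
      by the cube root of unity (-1 - sqrt(-3))/2 and \<open>?G\<close> by its conjugate; on odd
      pairs \<open>?F\<close> lands in integer coordinates.\<close>
    let ?F = "\<lambda>(a::int, b::int). (2 * b + 1 - (a + b + 1) div 2, - ((a + b + 1) div 2))"
    let ?G = "\<lambda>(m::int, n::int). ((- m - 3 * n - 1) div 2, (m - n - 1) div 2)"
    \<comment> \<open>Writing an odd pair as (2t + 1 - b, b) makes the divisions exact.\<close>
    have F: "?F (2 * t + 1 - b, b) = (2 * b - t, - t - 1)" for t b by simp
    have G: "?G (2 * k + 1 - n, n) = (- k - 1 - n, k - n)" for k n by simp
    have odd_cases: "\<exists>t b. p = (2 * t + 1 - b, b)" if "p \<in> odd_pairs" for p
    proof -
      obtain a b where p: "p = (a, b)" "odd (a + b)" using \<open>p \<in> odd_pairs\<close> by auto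
      then obtain t where "a + b = 2 * t + 1" by (elim oddE)
      then have "p = (2 * t + 1 - b, b)" using p by simp
      then show ?thesis by blast
    qed
    show ?thesis
    proof (rule theta_bij[where f = ?F])
      show "bij_betw ?F odd_pairs odd_pairs"
      proof (rule bij_betw_byWitness[where f' = ?G])
        show "\<forall>p\<in>odd_pairs. ?G (?F p) = p"
        proof
          fix p assume "p \<in> odd_pairs"
          then obtain t b where p: "p = (2 * t + 1 - b, b)" using odd_cases by blast
          have "?G (2 * b - t, - t - 1) = p" unfolding p by simp
          then show "?G (?F p) = p" unfolding p F by simp
        qed
        show "\<forall>p\<in>odd_pairs. ?F (?G p) = p"
        proof
          fix p assume "p \<in> odd_pairs"
          then obtain k n where p: "p = (2 * k + 1 - n, n)" using odd_cases by blast
          have "?F (- k - 1 - n, k - n) = p" unfolding p by simp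
          then show "?F (?G p) = p" unfolding p G by simp
        qed
        show "?F ` odd_pairs \<subseteq> odd_pairs"
        proof (rule image_subsetI)
          fix p assume "p \<in> odd_pairs"
          then obtain t b where p: "p = (2 * t + 1 - b, b)" using odd_cases by blast
          show "?F p \<in> odd_pairs" unfolding p F by simp
        qed
        show "?G ` odd_pairs \<subseteq> odd_pairs"
        proof (rule image_subsetI)
          fix p assume "p \<in> odd_pairs"
          then obtain k n where p: "p = (2 * k + 1 - n, n)" using odd_cases by blast
          show "?G p \<in> odd_pairs" unfolding p G by auto
        qed
      qed
      fix p assume "p \<in> odd_pairs"
      then obtain t b where p: "p = (2 * t + 1 - b, b)" using odd_cases by blast
      define a where "a = 2 * t + 1 - b"
      have "(2 * b - t)\<^sup>2 + 3 * (- t - 1)\<^sup>2 = a * (a + 1) + 3 * (b * (b + 1)) + 1"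
        unfolding a_def by (simp add: power2_eq_square algebra_simps)
      then have "int (nat ((2 * b - t)\<^sup>2) + 3 * nat ((- t - 1)\<^sup>2)) = int (nat (a * (a + 1)) + 3 * nat (b * (b + 1)) + 1)"
        using consecutive_nonneg by simp
      then show "?e (?F p) = ?f p"
        unfolding p F unfolding prod.case a_def[symmetric] by (simp only: of_nat_eq_iff)
    qed
  qed
  finally have R: "fps_X * (triang * dil 3 triang) = 2 * theta odd_pairs ?e" by simp
  have "dil 3 triang = 2 * dil 6 psi" by (simp add: triang_eq dil_mult dil_dil)
  then have "4 * fps_X * dil 2 psi * dil 6 psi = fps_X * (triang * dil 3 triang)"
    by (simp add: triang_eq)
  then show ?thesis unfolding L R by simp
qed

section \<open>Theta identities as identities between Euler products\<close>

lemma dil_E_square_psi: "k \<ge> 1 \<Longrightarrow> dil (2 * k) E ^ 2 = dil k E * dil k psi"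
  using arg_cong[OF psi_product, of "dil k"] by (simp add: dil_mult dil_power dil_dil mult.commute)

lemma qneg_E_square: "qneg E ^ 2 = dil 2 E * phi"
  using arg_cong[OF phi_product, of qneg] by (simp add: qneg_mult qneg_power qneg_dil_even)

lemma E_nonzero [simp]: "E \<noteq> 0" "dil k E \<noteq> 0"
  using E_nth_0 dil_nth_0[of k E] by (metis fps_zero_nth zero_neq_one)+

text \<open>In Euler products, the left side is E(-q)^2 E(q^4)^2 / E(q^2)^2, and
  \<open>qneg_E\<close> eliminates E(-q).\<close>

lemma phi_psi: "phi * dil 2 psi = psi ^ 2"
proof -
  have "(E * dil 2 E) ^ 2 * (phi * dil 2 psi) = (E * qneg E * dil 4 E) ^ 2"
    using dil_E_square_psi[of 2] qneg_E_square
    by (simp add: power_mult_distrib) (simp add: power2_eq_square mult_ac)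
  also have "\<dots> = (dil 2 E ^ 2) ^ 2 * dil 2 E ^ 2"
    unfolding qneg_E by (simp flip: power_mult power_add)
  also have "\<dots> = (E * psi) ^ 2 * dil 2 E ^ 2"
    by (simp only: psi_product)
  also have "\<dots> = (E * dil 2 E) ^ 2 * psi ^ 2"
    by (simp add: power_mult_distrib)
  finally show ?thesis by simp
qed

text \<open>Jacobi's identity phi(q)^4 - phi(-q)^4 = 16 q psi(q^2)^4, times E(q^2)^4. By
  \<open>phi_square\<close>, phi(q)^2 and phi(-q)^2 are P + 4qQ and P - 4qQ, so their squares differ
  by 16qPQ, and \<open>phi_psi\<close> evaluates PQ.\<close>

lemma quartic_identity: "qneg E ^ 8 - E ^ 8 = 16 * fps_X * dil 4 E ^ 8"
proof -
  let ?P = "dil 2 phi ^ 2" and ?Q = "dil 4 psi ^ 2"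
  have "dil 2 triang = 2 * dil 4 psi" by (simp add: triang_eq dil_mult dil_dil)
  then have phi: "phi ^ 2 = ?P + 4 * fps_X * ?Q"
    using phi_square by (simp add: power_mult_distrib)
  have nphi: "qneg phi ^ 2 = ?P - 4 * fps_X * ?Q"
    using arg_cong[OF phi, of qneg]
    by (simp add: qneg_mult qneg_power qneg_add qneg_dil_even qneg_X)
  have "(dil 2 phi * dil 4 psi) ^ 2 = (dil 2 psi ^ 2) ^ 2"
    using arg_cong[OF phi_psi, of "dil 2"] by (simp add: dil_mult dil_power dil_dil)
  then have PQ: "?P * ?Q = dil 2 psi ^ 4" by (simp add: power_mult_distrib flip: power_mult)
  have "qneg E ^ 8 - E ^ 8 = (qneg E ^ 2) ^ 4 - (E ^ 2) ^ 4" by (simp flip: power_mult)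
  also have "\<dots> = dil 2 E ^ 4 * ((phi ^ 2) ^ 2 - (qneg phi ^ 2) ^ 2)"
    unfolding qneg_E_square phi_product power_mult_distrib
    by (simp add: algebra_simps flip: power_mult)
  also have "(phi ^ 2) ^ 2 - (qneg phi ^ 2) ^ 2 = 16 * fps_X * (?P * ?Q)"
    unfolding phi nphi by (simp add: power2_eq_square algebra_simps)
  also have "dil 2 E ^ 4 * (16 * fps_X * (?P * ?Q)) = 16 * fps_X * (dil 2 E * dil 2 psi) ^ 4"
    unfolding PQ by (simp add: power_mult_distrib)
  also have "dil 2 E * dil 2 psi = dil 4 E ^ 2" using dil_E_square_psi[of 2] by simp
  finally show ?thesis by (simp flip: power_mult)
qed

text \<open>This is \<open>phi_phi3\<close> times E(q^2) E(q^6), a form of the modular equation of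
  degree 3.\<close>

lemma cubic_identity:
  "qneg E ^ 2 * qneg (dil 3 E) ^ 2 - E ^ 2 * dil 3 E ^ 2 = 4 * fps_X * dil 4 E ^ 2 * dil 12 E ^ 2"
proof -
  have n3: "qneg (dil 3 E) ^ 2 = dil 6 E * dil 3 phi"
    using arg_cong[OF qneg_E_square, of "dil 3"]
    by (simp add: qneg_dil_odd dil_mult dil_power dil_dil)
  have p3: "dil 3 E ^ 2 = dil 6 E * qneg (dil 3 phi)"
    using arg_cong[OF phi_product, of "dil 3"]
    by (simp add: qneg_dil_odd dil_mult dil_power dil_dil)
  have "qneg E ^ 2 * qneg (dil 3 E) ^ 2 - E ^ 2 * dil 3 E ^ 2
      = dil 2 E * dil 6 E * (phi * dil 3 phi - qneg (phi * dil 3 phi))"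
    unfolding qneg_E_square phi_product n3 p3 qneg_mult by (simp add: algebra_simps)
  also have "\<dots> = 4 * fps_X * (dil 2 E * dil 2 psi) * (dil 6 E * dil 6 psi)"
    unfolding phi_phi3 by (simp only: mult_ac)
  also have "\<dots> = 4 * fps_X * dil 4 E ^ 2 * dil 12 E ^ 2"
    using dil_E_square_psi[of 2] dil_E_square_psi[of 6] by simp
  finally show ?thesis .
qed

section \<open>Eta quotients of level 12\<close>

definition eta_u :: "rat fps" where
  "eta_u = fps_X * dil 2 E ^ 2 * dil 12 E ^ 4 * inverse (dil 4 E ^ 4 * dil 6 E ^ 2)"

definition eta_h :: "rat fps" where
  "eta_h = dil 2 E ^ 2 * dil 3 E ^ 3 * dil 12 E * inverse (E * dil 4 E ^ 3 * dil 6 E ^ 2)"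

definition eta_g :: "rat fps" where
  "eta_g = E ^ 3 * dil 12 E * inverse (dil 3 E * dil 4 E ^ 3)"

definition eta_w :: "rat fps" where
  "eta_w = E * dil 3 E ^ 5 * inverse (dil 2 E ^ 5 * dil 6 E)"

text \<open>Chosen so that \<open>dil 2 eta_t\<close> is \<open>eta_u ^ 2\<close>; likewise
  \<open>eta_w\<close>, the reciprocal of \<open>xi\<close>, dilates to
  \<open>eta_h * qneg eta_h\<close>.\<close>

definition eta_t :: "rat fps" where
  "eta_t = fps_X * E ^ 4 * dil 6 E ^ 8 * inverse (dil 2 E ^ 8 * dil 3 E ^ 4)"

lemma qneg_dil_3_E: "dil 3 E * qneg (dil 3 E) * dil 12 E = dil 6 E ^ 3"
  using arg_cong[OF qneg_E, of "dil 3"] by (simp add: qneg_dil_odd dil_mult dil_power dil_dil)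

lemma qneg_nth_0 [simp]: "qneg f $ 0 = f $ 0"
  by (simp add: qneg_nth)

text \<open>Laurent series form a field, so relations among eta quotients can be checked there by
  clearing denominators.\<close>

lemma fps_to_fls_inverse:
  fixes f :: "'a::field fps"
  assumes "f $ 0 \<noteq> 0"
  shows "fps_to_fls (inverse f) = inverse (fps_to_fls f)"
  using assms by (simp add: fls_inverse_fps_to_fls subdegree_eq_0)

lemmas dil_qneg_simps =
  dil_mult dil_power dil_inverse dil_dil dil_X dil_nth_0 qneg_mult qneg_power qneg_inverse
  qneg_dil_even qneg_X

lemmas fls_simps =
  fls_times_fps_to_fls fps_to_fls_power fps_to_fls_inverse dil_nth_0

lemma fls_qneg_E:
  "fps_to_fls (qneg E) = fps_to_fls (dil 2 E) ^ 3 / (fps_to_fls E * fps_to_fls (dil 4 E))"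
  "fps_to_fls (qneg (dil 3 E)) = fps_to_fls (dil 6 E) ^ 3 / (fps_to_fls (dil 3 E) * fps_to_fls (dil 12 E))"
  using arg_cong[OF qneg_E, of fps_to_fls] arg_cong[OF qneg_dil_3_E, of fps_to_fls]
  by (simp_all add: fls_simps field_simps)

lemmas eta_simps = eta_u_def eta_h_def eta_g_def eta_w_def eta_t_def dil_qneg_simps fls_simps fls_qneg_E

text \<open>Both sides are the same monomial in q and the E(q^d) once E(-q) and E(-q^3) are
  eliminated. The first three turn the theta identities into relations for \<open>eta_g\<close>,
  \<open>eta_h\<close>, \<open>eta_u\<close>; the next four serve to show that s^2 is fixed by q ->
  q^2; the last brings in \<open>xi\<close>.\<close>

lemma eta_monomials:
  "eta_g * eta_h * fps_X * dil 4 E ^ 2 * dil 12 E ^ 2 = eta_u * E ^ 2 * dil 3 E ^ 2"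
  "eta_g ^ 3 * eta_h * fps_X * dil 4 E ^ 8 = eta_u * E ^ 8"
  "eta_g * eta_h ^ 3 * fps_X ^ 3 * dil 12 E ^ 8 = eta_u ^ 3 * dil 3 E ^ 8"
  "eta_t * qneg eta_g = eta_u * qneg eta_h"
  "eta_w * qneg eta_g = eta_h ^ 2"
  "eta_h * qneg eta_h = dil 2 eta_w"
  "eta_u ^ 2 = dil 2 eta_t"
  "xi * eta_w = 1"
  unfolding fps_to_fls_eq_iff[symmetric] xi_def
  by (simp_all add: eta_simps, simp_all add: field_simps, (simp_all add: eval_nat_numeral)?)

definition gam_root :: "rat fps" where
  "gam_root = E * dil 2 E * dil 6 E * inverse (dil 3 E ^ 3)"

text \<open>All exponents in \<open>gam\<close> are multiples of 5, so the monomial check is done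
  for fifth roots and then raised to the fifth power.\<close>

lemma kappa_eta_h: "kappa * qneg eta_h ^ 5 = 1"
proof -
  have gam: "gam = gam_root ^ 5"
    by (simp add: gam_def gam_root_def power_mult_distrib fps_inverse_power flip: power_mult)
  have "kappa = (dil 2 gam_root ^ 2 * inverse gam_root) ^ 5"
    unfolding kappa_def gam
    by (simp add: dil_power power_mult_distrib fps_inverse_power mult.commute flip: power_mult)
  moreover have "dil 2 gam_root ^ 2 * inverse gam_root * qneg eta_h = 1"
    unfolding fps_to_fls_eq_iff[symmetric] gam_root_def
    by (simp add: eta_simps, simp add: field_simps, (simp add: eval_nat_numeral)?)
  ultimately show ?thesis by (metis power_mult_distrib power_one)
qed

section \<open>Elimination: \<open>eta_h\<close> and \<open>eta_g\<close> in terms of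
  \<open>eta_u\<close>\<close>

lemma eta_u_nth_0 [simp]: "eta_u $ 0 = 0" by (simp add: eta_u_def)

lemma eta_nth_0 [simp]: "eta_h $ 0 = 1" "eta_g $ 0 = 1"
  by (simp_all add: eta_h_def eta_g_def dil_nth_0 fps_power_zeroth)

lemma eta_u_nonzero: "eta_u \<noteq> 0"
  by (auto simp: eta_u_def dil_nth_0 fps_power_zeroth)

lemma qneg_eta_u: "qneg eta_u = - eta_u"
  by (simp add: eta_u_def dil_qneg_simps fps_power_zeroth)

lemma eta_relations:
  "qneg eta_g * qneg eta_h - eta_g * eta_h = 4 * eta_u"
  "qneg eta_g ^ 3 * qneg eta_h - eta_g ^ 3 * eta_h = 16 * eta_u"
  "qneg eta_g * qneg eta_h ^ 3 - eta_g * eta_h ^ 3 = 16 * eta_u ^ 3"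
proof -
  have quartic3: "qneg (dil 3 E) ^ 8 - dil 3 E ^ 8 = 16 * fps_X ^ 3 * dil 12 E ^ 8"
    using arg_cong[OF quartic_identity, of "dil 3"]
    by (simp add: qneg_dil_odd dil_diff dil_mult dil_power dil_dil dil_X)
  \<comment> \<open>In f m k = v e the odd factors m and v change sign together under q -> -q, so
    subtracting leaves the difference of e, which a theta identity evaluates.\<close>
  have diff: "qneg f - f = w" if "f * (m * k) = v * e" "qneg m = - m" "qneg k = k" "qneg v = - v"
      "qneg e - e = c * (m * k)" "v * c = w" "m * k \<noteq> 0" for f m k v e c w
  proof -
    have "qneg f * (m * k) = v * qneg e"
      using arg_cong[OF that(1), of qneg] that(2-4) by (simp add: qneg_mult)
    then have "(qneg f - f) * (m * k) = v * (qneg e - e)"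
      using that(1) by (simp add: algebra_simps)
    also have "\<dots> = w * (m * k)" using that(5,6) by (simp add: mult_ac)
    finally show ?thesis using that(7) by simp
  qed
  show "qneg eta_g * qneg eta_h - eta_g * eta_h = 4 * eta_u"
    using diff[of "eta_g * eta_h" fps_X "dil 4 E ^ 2 * dil 12 E ^ 2" eta_u "E ^ 2 * dil 3 E ^ 2" 4]
      eta_monomials(1) cubic_identity
    by (simp add: qneg_mult qneg_power qneg_eta_u qneg_X qneg_dil_even mult_ac)
  show "qneg eta_g ^ 3 * qneg eta_h - eta_g ^ 3 * eta_h = 16 * eta_u"
    using diff[of "eta_g ^ 3 * eta_h" fps_X "dil 4 E ^ 8" eta_u "E ^ 8" 16] eta_monomials(2) quartic_identity
    by (simp add: qneg_mult qneg_power qneg_eta_u qneg_X qneg_dil_even mult_ac)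
  show "qneg eta_g * qneg eta_h ^ 3 - eta_g * eta_h ^ 3 = 16 * eta_u ^ 3"
    using diff[of "eta_g * eta_h ^ 3" "fps_X ^ 3" "dil 12 E ^ 8" "eta_u ^ 3" "dil 3 E ^ 8" 16] eta_monomials(3) quartic3
    by (simp add: qneg_mult qneg_power qneg_eta_u qneg_X qneg_dil_even mult_ac)
qed

text \<open>The first and third relations are linear in \<open>eta_g * eta_h\<close> and its image
  under \<open>qneg\<close>. Solving them and substituting in the second leaves an equation in A, B,
  v alone, which factors.\<close>

lemma eta_h_odd_part: "eta_h - qneg eta_h = 2 * eta_u \<or> eta_h - qneg eta_h = - 2 * eta_u"
proof -
  define A B v where "A = eta_h ^ 2" and "B = qneg eta_h ^ 2" and "v = 4 * eta_u ^ 2"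
  note E = eta_relations
  have a: "eta_g * eta_h * (A - B) = 4 * eta_u * (B - v)"
    using E(1,3) unfolding A_def B_def v_def by algebra
  have b: "qneg eta_g * qneg eta_h * (A - B) = 4 * eta_u * (A - v)"
    using E(1,3) unfolding A_def B_def v_def by algebra
  \<comment> \<open>The factor A B (A - B)^3 turns the cubes of \<open>eta_g\<close> into cubes of
    the solved expressions \<open>a\<close> and \<open>b\<close>.\<close>
  have "16 * eta_u * (A * B * (A - B) ^ 3) = (qneg eta_g ^ 3 * qneg eta_h - eta_g ^ 3 * eta_h) * (A * B * (A - B) ^ 3)"
    unfolding E(2) ..
  also have "\<dots> = (qneg eta_g * qneg eta_h * (A - B)) ^ 3 * A - (eta_g * eta_h * (A - B)) ^ 3 * B"
    unfolding A_def B_def by algebra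
  also have "\<dots> = 16 * eta_u * (v * (A * (A - v) ^ 3 - B * (B - v) ^ 3))"
    unfolding a b unfolding v_def by algebra
  finally have c: "A * B * (A - B) ^ 3 = v * (A * (A - v) ^ 3 - B * (B - v) ^ 3)"
    using eta_u_nonzero by simp
  have nth0: "A $ 0 = 1" "B $ 0 = 1" "v $ 0 = 0"
    by (simp_all add: A_def B_def v_def fps_power_zeroth)
  then have "(A - v) $ 0 \<noteq> 0" "(B - v) $ 0 \<noteq> 0" by simp_all
  then have Av: "A - v \<noteq> 0" "B - v \<noteq> 0" by auto
  have "A - B \<noteq> 0" using a Av eta_u_nonzero by auto
  moreover have "(A - B) * ((4 * A * B - (A + B - v) ^ 2) * ((A - v) * (B - v))) = 0"
    using c by algebra
  ultimately have "4 * A * B - (A + B - v) ^ 2 = 0" using Av by simp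
  \<comment> \<open>A difference of squares, as 4AB is the square of 2
    \<open>eta_h * qneg eta_h\<close>; the second factor has constant term 4.\<close>
  then have "(v - (eta_h - qneg eta_h) ^ 2) * ((eta_h + qneg eta_h) ^ 2 - v) = 0"
    unfolding A_def B_def by algebra
  moreover have "((eta_h + qneg eta_h) ^ 2 - v) $ 0 \<noteq> 0" using nth0 by (simp add: fps_power_zeroth)
  then have "(eta_h + qneg eta_h) ^ 2 - v \<noteq> 0" by auto
  ultimately have "v - (eta_h - qneg eta_h) ^ 2 = 0" by simp
  then have "(eta_h - qneg eta_h - 2 * eta_u) * (eta_h - qneg eta_h - - 2 * eta_u) = 0"
    unfolding v_def by algebra
  then show ?thesis by (simp only: mult_eq_0_iff right_minus_eq)
qed

text \<open>The sign in \<open>eta_h - qneg eta_h = \<plusminus> 2 * eta_u\<close> is decided by the constant term of \<open>eta_g\<close>.\<close>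
lemma eta_h_decomp:
  obtains s where "s $ 0 = 1" "eta_h = s + eta_u" "qneg eta_h = s - eta_u" "eta_g * s = s - 3 * eta_u"
    "qneg eta_g * s = s + 3 * eta_u"
proof -
  have a: "eta_g * eta_h * (eta_h ^ 2 - qneg eta_h ^ 2) = 4 * eta_u * (qneg eta_h ^ 2 - 4 * eta_u ^ 2)"
    using eta_relations(1,3) by algebra
  have hh0: "eta_h \<noteq> 0" "qneg eta_h \<noteq> 0"
    using eta_nth_0(1) qneg_nth_0[of eta_h] by (metis fps_zero_nth zero_neq_one)+
  from eta_h_odd_part show ?thesis
  proof
    assume *: "eta_h - qneg eta_h = - 2 * eta_u"
    define s where "s = eta_h + eta_u"
    have s: "eta_h = s - eta_u" "qneg eta_h = s + eta_u" using * by (simp_all add: s_def algebra_simps)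
    have "4 * eta_u * eta_h * (eta_g * s + (s + 3 * eta_u)) = 0"
      using a unfolding s(2) unfolding s(1) by algebra
    then have "eta_g * s + (s + 3 * eta_u) = 0" using hh0 eta_u_nonzero by simp
    \<comment> \<open>With this sign the constant term would be 1 + 1.\<close>
    then have "(eta_g * s + (s + 3 * eta_u)) $ 0 = 0" by simp
    then have False by (simp add: s_def)
    then show ?thesis ..
  next
    assume *: "eta_h - qneg eta_h = 2 * eta_u"
    define s where "s = eta_h - eta_u"
    have s: "eta_h = s + eta_u" "qneg eta_h = s - eta_u" using * by (simp_all add: s_def algebra_simps)
    have "4 * eta_u * eta_h * (eta_g * s - (s - 3 * eta_u)) = 0"
      using a unfolding s(2) unfolding s(1) by algebra
    then have g: "eta_g * s = s - 3 * eta_u" using hh0 eta_u_nonzero by simp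
    have "qneg s = s" using s(2) by (simp add: s_def qneg_diff qneg_eta_u)
    then have "qneg eta_g * s = s + 3 * eta_u"
      using arg_cong[OF g, of qneg] by (simp add: qneg_mult qneg_diff qneg_eta_u)
    then show ?thesis using that[of s] s g by (simp add: s_def)
  qed
qed

text \<open>Odd coefficients vanish and an even one equals that at half its index, so halving
  repeatedly kills every coefficient but the constant one.\<close>

lemma dil_2_fixed:
  assumes "dil 2 f = f"
  shows "f = fps_const (f $ 0)"
proof (rule fps_ext)
  fix n
  show "f $ n = fps_const (f $ 0) $ n"
  proof (induction n rule: less_induct)
    case (less n)
    have "f $ n = (if even n then f $ (n div 2) else 0)"
      using arg_cong[OF assms, of "\<lambda>f. f $ n"] by (simp add: dil_nth)
    then show ?case using less[of "n div 2"] by (cases "n = 0") auto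
  qed
qed

text \<open>The series \<open>s\<^sup>2\<close> equals both \<open>eta_w + eta_t\<close> and \<open>dil 2 (eta_w + eta_t)\<close>, hence is constant.\<close>
lemma eta_linear: "eta_h = 1 + eta_u" "qneg eta_h = 1 - eta_u" "qneg eta_g = 1 + 3 * eta_u"
proof -
  obtain s where s: "s $ 0 = 1" "eta_h = s + eta_u" "qneg eta_h = s - eta_u" "qneg eta_g * s = s + 3 * eta_u"
    using eta_h_decomp by metis
  have gg0: "qneg eta_g \<noteq> 0"
    using eta_nth_0(2) qneg_nth_0[of eta_g] by (metis fps_zero_nth zero_neq_one)
  have "qneg eta_g * (eta_w + eta_t) = eta_h ^ 2 + eta_u * qneg eta_h"
    using eta_monomials(4,5) by (simp add: algebra_simps)
  \<comment> \<open>Indeed (s + u)^2 + u(s - u) = s(s + 3u).\<close>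
  also have "\<dots> = s * (qneg eta_g * s)"
    unfolding s(4) unfolding s(3) unfolding s(2) by algebra
  finally have "qneg eta_g * (eta_w + eta_t) = qneg eta_g * s ^ 2" by (simp add: power2_eq_square mult_ac)
  then have "eta_w + eta_t = s ^ 2" using gg0 by simp
  moreover have "dil 2 (eta_w + eta_t) = s ^ 2"
    unfolding dil_add eta_monomials(6,7)[symmetric] s(3) unfolding s(2) by algebra
  ultimately have "s ^ 2 = fps_const ((s ^ 2) $ 0)" using dil_2_fixed by metis
  then have "(s - 1) * (s + 1) = 0" using s(1) by (simp add: fps_power_zeroth power2_eq_square algebra_simps)
  moreover have "(s + 1) $ 0 \<noteq> 0" using s(1) by simp
  then have "s + 1 \<noteq> 0" by (metis fps_zero_nth)
  ultimately have "s = 1" by simp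
  then show "eta_h = 1 + eta_u" "qneg eta_h = 1 - eta_u" "qneg eta_g = 1 + 3 * eta_u" using s by simp_all
qed

section \<open>The recurrences\<close>

lemma dil_2_xi: "dil 2 xi * (1 - eta_u ^ 2) = 1"
proof -
  have "dil 2 xi * (eta_h * qneg eta_h) = 1"
    using arg_cong[OF eta_monomials(8), of "dil 2"] unfolding eta_monomials(6) by (simp add: dil_mult)
  then show ?thesis unfolding eta_linear(2) unfolding eta_linear(1) by (simp add: power2_eq_square algebra_simps)
qed

text \<open>Dividing by (1 + u)^2 is multiplying by (1 - u)^2 and the square of
  \<open>dil 2 xi\<close>, which keeps everything polynomial.\<close>

lemma xi_eta_u: "xi = dil 2 xi ^ 2 * ((1 - eta_u) ^ 2 * (1 + 3 * eta_u))"
proof -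
  have "xi * eta_h ^ 2 = (xi * eta_w) * qneg eta_g" unfolding eta_monomials(5)[symmetric] by (simp only: mult_ac)
  then have "xi * (1 + eta_u) ^ 2 = 1 + 3 * eta_u" unfolding eta_monomials(8) eta_linear(3) unfolding eta_linear(1) by simp
  then show ?thesis using dil_2_xi by algebra
qed

lemma qneg_xi_eta_u: "qneg xi = dil 2 xi ^ 2 * ((1 + eta_u) ^ 2 * (1 - 3 * eta_u))"
  using arg_cong[OF xi_eta_u, of qneg]
  by (simp add: qneg_mult qneg_power qneg_diff qneg_add qneg_eta_u qneg_dil_even)

text \<open>\<open>xi\<close> and \<open>qneg xi\<close> are the two roots: their sum and product
  are even in \<open>eta_u\<close>, and u^2 is removed through x(1 - u^2) = 1 with x =
  \<open>dil 2 xi\<close>.\<close>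

lemma xi_quadratic: "xi ^ 2 = dil 2 (10 * xi - 8 * xi ^ 2) * xi - dil 2 (9 * xi - 8 * xi ^ 2)"
proof -
  let ?x = "dil 2 xi"
  have "xi + qneg xi = 10 * ?x - 8 * ?x ^ 2"
    using dil_2_xi unfolding qneg_xi_eta_u by (subst xi_eta_u) algebra
  moreover have "xi * qneg xi = 9 * ?x - 8 * ?x ^ 2"
    using dil_2_xi unfolding qneg_xi_eta_u by (subst xi_eta_u) algebra
  ultimately have "xi ^ 2 = (10 * ?x - 8 * ?x ^ 2) * xi - (9 * ?x - 8 * ?x ^ 2)" by algebra
  moreover have "dil 2 (10 * xi - 8 * xi ^ 2) = 10 * ?x - 8 * ?x ^ 2"
    "dil 2 (9 * xi - 8 * xi ^ 2) = 9 * ?x - 8 * ?x ^ 2"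
    by (simp_all add: dil_diff dil_mult dil_power)
  ultimately show ?thesis by (simp only:)
qed

lemma kappa_eta_u: "kappa = dil 2 xi ^ 5 * (1 + eta_u) ^ 5"
proof -
  \<comment> \<open>Inserting 1 as a fifth power clears the denominator (1 - u)^5.\<close>
  have "kappa = kappa * (dil 2 xi * (1 - eta_u ^ 2)) ^ 5" unfolding dil_2_xi by simp
  also have "dil 2 xi * (1 - eta_u ^ 2) = dil 2 xi * (1 + eta_u) * qneg eta_h"
    unfolding eta_linear(2) by (simp add: power2_eq_square algebra_simps)
  also have "kappa * (dil 2 xi * (1 + eta_u) * qneg eta_h) ^ 5 = (kappa * qneg eta_h ^ 5) * (dil 2 xi ^ 5 * (1 + eta_u) ^ 5)"
    unfolding power_mult_distrib by (simp only: mult_ac)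
  finally show ?thesis unfolding kappa_eta_h by simp
qed

lemma qneg_kappa_eta_u: "qneg kappa = dil 2 xi ^ 5 * (1 - eta_u) ^ 5"
  using arg_cong[OF kappa_eta_u, of qneg]
  by (simp add: qneg_mult qneg_power qneg_add qneg_eta_u qneg_dil_even)

lemma kappa_quadratic:
  "kappa ^ 2 = dil 2 (10 * xi ^ 3 - 40 * xi ^ 4 + 32 * xi ^ 5) * kappa - dil 2 (xi ^ 5)"
proof -
  let ?x = "dil 2 xi"
  have "kappa + qneg kappa = ?x ^ 5 * ((1 + eta_u) ^ 5 + (1 - eta_u) ^ 5)"
    unfolding qneg_kappa_eta_u unfolding kappa_eta_u by (simp only: distrib_left)
  also have "(1 + eta_u) ^ 5 + (1 - eta_u) ^ 5 = 2 + 20 * eta_u ^ 2 + 10 * (eta_u ^ 2) ^ 2" by algebra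
  \<comment> \<open>Powers of x are distributed so that u^2 occurs only in x u^2 = x - 1.\<close>
  also have "?x ^ 5 * (2 + 20 * eta_u ^ 2 + 10 * (eta_u ^ 2) ^ 2)
      = ?x ^ 3 * (2 * ?x ^ 2 + 20 * ?x * (?x * eta_u ^ 2) + 10 * (?x * eta_u ^ 2) ^ 2)"
    by algebra
  also have "?x * eta_u ^ 2 = ?x - 1" using dil_2_xi by algebra
  also have "?x ^ 3 * (2 * ?x ^ 2 + 20 * ?x * (?x - 1) + 10 * (?x - 1) ^ 2) = 10 * ?x ^ 3 - 40 * ?x ^ 4 + 32 * ?x ^ 5"
    by algebra
  finally have sum: "kappa + qneg kappa = 10 * ?x ^ 3 - 40 * ?x ^ 4 + 32 * ?x ^ 5" .
  have "kappa * qneg kappa = ?x ^ 5 * (?x * ((1 + eta_u) * (1 - eta_u))) ^ 5"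
    unfolding qneg_kappa_eta_u unfolding kappa_eta_u power_mult_distrib by (simp only: mult_ac)
  also have "(1 + eta_u) * (1 - eta_u) = 1 - eta_u ^ 2" by algebra
  finally have "kappa * qneg kappa = ?x ^ 5" unfolding dil_2_xi by simp
  then have "kappa ^ 2 = (kappa + qneg kappa) * kappa - ?x ^ 5" by algebra
  then show ?thesis unfolding sum by (simp add: dil_diff dil_add dil_mult dil_power)
qed

section \<open>The operator U and the recurrences\<close>

lemma U_diff: "U (f - g) = U f - U g"
  by (rule fps_ext) (simp add: U_def)

text \<open>A series in q^2 has only even exponents, so U passes it through with q^2 replaced by
  q.\<close>

lemma U_dil_mult: "U (dil 2 g * f) = g * U f"
proof (rule fps_ext)
  fix n
  have "U (dil 2 g * f) $ n = (\<Sum>i\<in>{0..2 * n}. dil 2 g $ i * f $ (2 * n - i))"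
    by (simp add: U_def fps_mult_nth)
  also have "\<dots> = (\<Sum>i\<in>(*) 2 ` {0..n}. dil 2 g $ i * f $ (2 * n - i))"
    by (rule sum.mono_neutral_right) (auto simp: dil_nth image_iff elim!: evenE)
  also have "\<dots> = (\<Sum>i\<in>{0..n}. g $ i * f $ (2 * (n - i)))"
    by (subst sum.reindex) (auto simp: dil_nth inj_on_def right_diff_distrib')
  finally show "U (dil 2 g * f) $ n = (g * U f) $ n"
    by (simp add: U_def fps_mult_nth)
qed

text \<open>Multiply the quadratic equation by f^(n-2) w and apply U. The factor \<open>w\<close>
  carries the power of the other series, so that one lemma serves both \<open>kappa\<close> and
  \<open>xi\<close>.\<close>

lemma U_recurrence:
  assumes "f ^ 2 = dil 2 p * f - dil 2 r" "n \<ge> 2"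
  shows "U (f ^ n * w) = p * U (f ^ (n - 1) * w) - r * U (f ^ (n - 2) * w)"
proof -
  obtain m where n: "n = m + 2" using assms(2) by (metis add.commute le_Suc_ex)
  have "f ^ n * w = (f ^ 2) * (f ^ m * w)" unfolding n power_add by (simp only: mult_ac)
  also have "\<dots> = dil 2 p * (f ^ (m + 1) * w) - dil 2 r * (f ^ m * w)"
    unfolding assms(1) by (simp add: algebra_simps)
  finally show ?thesis by (simp add: n U_diff U_dil_mult)
qed

theorem theorem2p4:
  shows "(\<forall>i j. i \<ge> 2 \<longrightarrow>
           zeta i j = (10 * xi ^ 3 - 40 * xi ^ 4 + 32 * xi ^ 5) * zeta (i - 1) j
                      - xi ^ 5 * zeta (i - 2) j)
       \<and> (\<forall>i j. j \<ge> 2 \<longrightarrow>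
           zeta i j = (10 * xi - 8 * xi ^ 2) * zeta i (j - 1)
                      - (9 * xi - 8 * xi ^ 2) * zeta i (j - 2))"
  using U_recurrence[OF kappa_quadratic] U_recurrence[OF xi_quadratic, of _ "kappa ^ _"]
  by (simp add: zeta_def mult.commute[of "kappa ^ _"])

end
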